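(* Let $A$ be a complex torus of dimension $n$. Let $\varphi\in NS_A$ be nondegenerate, i.e. $\varphi\in\mathrm{Hom}(A,\hat A)$ is an isogeny. Let $\tau=a+ib\in\mathbb C$, $b\neq0$. Consider the element $\omega_A:=\tau\varphi\in NS_A(\mathbb C)^0$ and the weak pair $(A,\omega_A)$. Then there exist isogeneous elliptic curves $E_1,\dots,E_n$ and an element $\omega_E\in NS_E(\mathbb C)^0$, where $E=E_1\times\dots\times E_n$, such that the weak pair $(E,\omega_E)$ is mirror symmetric to the weak pair $(A,\omega_A)$.
   Context: A complex torus is $A=(V/\Gamma,J)$ with $\Gamma=\Gamma_A=H_1(A,\mathbb Z)$ a lattice of rank $2\dim A$, $V=V_A=\Gamma\otimes\mathbb R$, and $J=J_A\in\mathrm{End}(V)$, $J^2=-1$. The dual torus is $\hat A=(V^*/\Gamma^*,\hat J)$, $(\hat Jw)(v)=w(-Jv)$. The Néron–Severi group $NS_A$ is identified (by first Chern class) with the group of integral skew-symmetric forms $c$ on $\Gamma$ with $c_{\mathbb R}$ $J$-invariant, and with a subgroup of $\mathrm{Hom}(A,\hat A)$ via $c\mapsto(v\mapsto c(v,\cdot))$. $NS_A(\mathbb R)=NS_A\otimes\mathbb R$, $NS_A(\mathbb C)=NS_A\otimes\mathbb C$, $NS_A(\mathbb R)^0\subset NS_A(\mathbb R)$ is the set of nondegenerate forms, and $NS_A(\mathbb C)^0=\{\varphi_1+i\varphi_2\in NS_A(\mathbb C):\varphi_1\in NS_A(\mathbb R),\ \varphi_2\in NS_A(\mathbb R)^0\}$.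 Put $\Lambda_A=\Gamma_A\oplus\Gamma_{\hat A}$ ($\Gamma_{\hat A}=\Gamma_A^*$) with $Q_A((a_1,b_1),(a_2,b_2))=b_1(a_2)+b_2(a_1)$; $J_{A\times\hat A}=(J,\hat J)$ acts on $V_A\oplus V_{\hat A}$. For $\omega=\varphi_1+i\varphi_2\in NS_A(\mathbb C)^0$ (with $\varphi_k:V_A\to V_{\hat A}$) put $$I_\omega=\begin{pmatrix}\varphi_2^{-1}\varphi_1&-\varphi_2^{-1}\\ \varphi_2+\varphi_1\varphi_2^{-1}\varphi_1&-\varphi_1\varphi_2^{-1}\end{pmatrix},$$ a complex structure on $V_A\oplus V_{\hat A}$. A weak pair $(A,\omega_A)$ is a complex torus $A$ with $\omega_A\in NS_A(\mathbb C)^0$. Weak pairs $(A,\omega_A)$, $(B,\omega_B)$ are mirror symmetric if there is an isomorphism $\alpha:\Lambda_A\to\Lambda_B$ identifying $Q_A$ with $Q_B$ such that $\alpha_{\mathbb R}J_{A\times\hat A}=I_{\omega_B}\alpha_{\mathbb R}$ and $\alpha_{\mathbb R}I_{\omega_A}=J_{B\times\hat B}\alpha_{\mathbb R}$. *)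

theory Defs
  imports "HOL-Analysis.Analysis"
begin

(* A complex torus (V/\<Gamma>, J): the real vector space V is the carrier type, the lattice \<Gamma> is
   embedded in V, so that \<Gamma> \<otimes> \<real> = V becomes the requirement that \<Gamma> be a full lattice.
   The norm on V plays no role: V is finite dimensional as soon as it has a full lattice. *)
record (overloaded) ('v::real_normed_vector) ctorus =
  periods :: "'v set"
  cstruct :: "'v \<Rightarrow>\<^sub>L 'v"

definition full_lattice :: "'v::real_normed_vector set \<Rightarrow> bool" where
  "full_lattice \<Gamma> \<longleftrightarrow> (\<exists>B. finite B \<and> independent B \<and> span B = UNIV \<and>
      \<Gamma> = {(\<Sum>b\<in>B. of_int (k b) *\<^sub>R b) | k :: 'v \<Rightarrow> int. True})"

definition complex_torus :: "'v::real_normed_vector ctorus \<Rightarrow> bool" where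
  "complex_torus A \<longleftrightarrow> full_lattice (periods A) \<and> cstruct A o\<^sub>L cstruct A = - id_blinfun"

definition torus_dim :: "'v::real_normed_vector ctorus \<Rightarrow> nat" where
  "torus_dim A = dim (UNIV :: 'v set) div 2"

definition dual_torus :: "'v::real_normed_vector ctorus \<Rightarrow> ('v \<Rightarrow>\<^sub>L real) ctorus" where
  "dual_torus A = \<lparr> periods = {w. \<forall>\<gamma>\<in>periods A. blinfun_apply w \<gamma> \<in> \<int>},
                    cstruct = Blinfun (\<lambda>w. w o\<^sub>L (- cstruct A)) \<rparr>"

definition prod_torus :: "('n::finite \<Rightarrow> 'v::real_normed_vector ctorus) \<Rightarrow> ('v ^ 'n) ctorus" where
  "prod_torus E = \<lparr> periods = {x. \<forall>i. x $ i \<in> periods (E i)},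
                    cstruct = Blinfun (\<lambda>x. \<chi> i. cstruct (E i) (x $ i)) \<rparr>"

definition elliptic_curve :: "'v::real_normed_vector ctorus \<Rightarrow> bool" where
  "elliptic_curve A \<longleftrightarrow> complex_torus A \<and> torus_dim A = 1"

(* Homomorphisms of tori, given by the induced real-linear maps on the universal covers. *)
definition torus_hom ::
  "'v::real_normed_vector ctorus \<Rightarrow> 'w::real_normed_vector ctorus \<Rightarrow> ('v \<Rightarrow>\<^sub>L 'w) set" where
  "torus_hom A B = {f. (\<forall>\<gamma>\<in>periods A. blinfun_apply f \<gamma> \<in> periods B) \<and>
                      f o\<^sub>L cstruct A = cstruct B o\<^sub>L f}"

(* Surjective with finite kernel, both for the induced map of quotients by the period lattices;
   the kernel is the preimage of the periods of B modulo the periods of A. *)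
definition isogeny ::
  "'v::real_normed_vector ctorus \<Rightarrow> 'w::real_normed_vector ctorus \<Rightarrow> ('v \<Rightarrow>\<^sub>L 'w) \<Rightarrow> bool" where
  "isogeny A B f \<longleftrightarrow> f \<in> torus_hom A B \<and>
     (\<forall>y. \<exists>x. y - f x \<in> periods B) \<and>
     finite ({x. f x \<in> periods B} // {(x, y). x - y \<in> periods A})"

definition isogenous ::
  "'v::real_normed_vector ctorus \<Rightarrow> 'w::real_normed_vector ctorus \<Rightarrow> bool" where
  "isogenous A B \<longleftrightarrow> (\<exists>f. isogeny A B f)"

(* A bilinear form c on V is stored in curried form, so that it is at the same time the map
   v \<mapsto> c(v, -) from V to the dual of V. *)
type_synonym 'v form = "'v \<Rightarrow>\<^sub>L ('v \<Rightarrow>\<^sub>L real)"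

definition NS :: "'v::real_normed_vector ctorus \<Rightarrow> 'v form set" where
  "NS A = {c. (\<forall>v w. blinfun_apply (blinfun_apply c v) w = - c w v) \<and>
              (\<forall>v\<in>periods A. \<forall>w\<in>periods A. c v w \<in> \<int>) \<and>
              (\<forall>v w. c (cstruct A v) (cstruct A w) = c v w)}"

(* NS \<otimes> \<real> is the real span: integrally independent integral forms stay independent over \<real>. *)
definition NS_R :: "'v::real_normed_vector ctorus \<Rightarrow> 'v form set" where
  "NS_R A = span (NS A)"

definition nondegenerate :: "'v::real_normed_vector form \<Rightarrow> bool" where
  "nondegenerate c \<longleftrightarrow> (\<forall>v. (\<forall>w. c v w = 0) \<longrightarrow> v = 0)"

(* The pair (\<phi>1, \<phi>2) stands for \<phi>1 + i \<phi>2 in NS \<otimes> \<complex>. *)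
definition NS_C0 :: "'v::real_normed_vector ctorus \<Rightarrow> ('v form \<times> 'v form) set" where
  "NS_C0 A = {(\<phi>1, \<phi>2). \<phi>1 \<in> NS_R A \<and> \<phi>2 \<in> NS_R A \<and> nondegenerate \<phi>2}"

(* The product \<tau> \<phi> of a complex number and a real form, as an element of NS \<otimes> \<complex>. *)
definition cscale :: "complex \<Rightarrow> 'v::real_normed_vector form \<Rightarrow> 'v form \<times> 'v form" where
  "cscale \<tau> \<phi> = (Re \<tau> *\<^sub>R \<phi>, Im \<tau> *\<^sub>R \<phi>)"

definition Lambda :: "'v::real_normed_vector ctorus \<Rightarrow> ('v \<times> ('v \<Rightarrow>\<^sub>L real)) set" where
  "Lambda A = periods A \<times> periods (dual_torus A)"

fun Q_form ::
  "'v::real_normed_vector \<times> ('v \<Rightarrow>\<^sub>L real) \<Rightarrow> 'v \<times> ('v \<Rightarrow>\<^sub>L real) \<Rightarrow> real" where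
  "Q_form (a1, b1) (a2, b2) = b1 a2 + b2 a1"

fun J_prod_dual ::
  "'v::real_normed_vector ctorus \<Rightarrow> 'v \<times> ('v \<Rightarrow>\<^sub>L real) \<Rightarrow> 'v \<times> ('v \<Rightarrow>\<^sub>L real)" where
  "J_prod_dual A (v, w) = (cstruct A v, cstruct (dual_torus A) w)"

fun I_omega ::
  "'v::real_normed_vector form \<times> 'v form \<Rightarrow> 'v \<times> ('v \<Rightarrow>\<^sub>L real) \<Rightarrow> 'v \<times> ('v \<Rightarrow>\<^sub>L real)" where
  "I_omega (\<phi>1, \<phi>2) (v, w) =
     (let \<psi> = inv (blinfun_apply \<phi>2)
      in (\<psi> (\<phi>1 v) - \<psi> w,
          (\<phi>2 v + \<phi>1 (\<psi> (\<phi>1 v))) - \<phi>1 (\<psi> w)))"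

fun weak_pair :: "'v::real_normed_vector ctorus \<times> ('v form \<times> 'v form) \<Rightarrow> bool" where
  "weak_pair (A, \<omega>) \<longleftrightarrow> complex_torus A \<and> \<omega> \<in> NS_C0 A"

(* \<alpha> below is the real extension of the lattice isomorphism; a group isomorphism of full lattices
   is the restriction of exactly one real-linear map. *)
fun mirror_symmetric ::
  "'v::real_normed_vector ctorus \<times> ('v form \<times> 'v form) \<Rightarrow>
   'w::real_normed_vector ctorus \<times> ('w form \<times> 'w form) \<Rightarrow> bool" where
  "mirror_symmetric (A, \<omega>A) (B, \<omega>B) \<longleftrightarrow>
     weak_pair (A, \<omega>A) \<and> weak_pair (B, \<omega>B) \<and>
     (\<exists>\<alpha> :: 'v \<times> ('v \<Rightarrow>\<^sub>L real) \<Rightarrow> 'w \<times> ('w \<Rightarrow>\<^sub>L real).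
        linear \<alpha> \<and> bij_betw \<alpha> (Lambda A) (Lambda B) \<and>
        (\<forall>x\<in>Lambda A. \<forall>y\<in>Lambda A. Q_form (\<alpha> x) (\<alpha> y) = Q_form x y) \<and>
        \<alpha> \<circ> J_prod_dual A = I_omega \<omega>B \<circ> \<alpha> \<and>
        \<alpha> \<circ> I_omega \<omega>A = J_prod_dual B \<circ> \<alpha>)"

(* The two uses of Blinfun above are never on junk values. *)

lemma cstruct_dual_torus:
  fixes A :: "'v::real_normed_vector ctorus"
  shows "cstruct (dual_torus A) w v = w (- cstruct A v)"
proof -
  have "bounded_linear (\<lambda>w :: 'v \<Rightarrow>\<^sub>L real. w o\<^sub>L (- cstruct A))"
    by (rule bounded_bilinear.bounded_linear_left[OF bounded_bilinear_blinfun_compose])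
  then show ?thesis
    by (simp add: dual_torus_def bounded_linear_Blinfun_apply blinfun.minus_left blinfun.minus_right)
qed

lemma cstruct_prod_torus:
  fixes E :: "'n::finite \<Rightarrow> 'v::real_normed_vector ctorus"
  shows "cstruct (prod_torus E) x $ i = cstruct (E i) (x $ i)"
proof -
  have "bounded_linear (\<lambda>x. \<chi> i. cstruct (E i) (x $ i))"
  proof (rule bounded_linear_intro)
    fix x y :: "'v ^ 'n" and r :: real
    show "(\<chi> i. cstruct (E i) ((x + y) $ i)) =
        (\<chi> i. cstruct (E i) (x $ i)) + (\<chi> i. cstruct (E i) (y $ i))"
      by (simp add: vec_eq_iff blinfun.add_right)
    show "(\<chi> i. cstruct (E i) ((r *\<^sub>R x) $ i)) = r *\<^sub>R (\<chi> i. cstruct (E i) (x $ i))"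
      by (simp add: vec_eq_iff blinfun.scaleR_right)
    have "norm (\<chi> i. cstruct (E i) (x $ i)) \<le> (\<Sum>i\<in>UNIV. norm (cstruct (E i) (x $ i)))"
      by (simp add: norm_vec_def L2_set_le_sum)
    also have "\<dots> \<le> (\<Sum>i\<in>UNIV. norm x * norm (cstruct (E i)))"
    proof (rule sum_mono)
      fix i
      have "norm (cstruct (E i) (x $ i)) \<le> norm (cstruct (E i)) * norm (x $ i)"
        by (rule norm_blinfun)
      also have "\<dots> \<le> norm x * norm (cstruct (E i))"
        using Finite_Cartesian_Product.norm_nth_le[of x i]
        by (simp add: mult.commute mult_right_mono)
      finally show "norm (cstruct (E i) (x $ i)) \<le> norm x * norm (cstruct (E i))" .
    qed
    finally show "norm (\<chi> i. cstruct (E i) (x $ i)) \<le> norm x * (\<Sum>i\<in>UNIV. norm (cstruct (E i)))"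
      by (simp add: sum_distrib_left)
  qed
  then show ?thesis
    by (simp add: prod_torus_def bounded_linear_Blinfun_apply)
qed

end

theory Submission imports Defs begin

text \<open>
  Let \<open>e i\<close>, \<open>f i\<close> be a basis of the period lattice of \<open>A\<close> in which \<open>\<phi>\<close> is an orthogonal sum of
  hyperbolic planes with \<open>\<phi> (e i) (f i) = d i > 0\<close>, and let \<open>e\<^sup>* i\<close>, \<open>f\<^sup>* i\<close> be the
  dual basis. The complex structure \<open>I_omega\<close> of
  \<open>\<tau> \<phi>\<close> maps each plane spanned by \<open>e i\<close> and \<open>f\<^sup>* i\<close> to itself, and likewise the planes spanned by
  \<open>f i\<close> and \<open>e\<^sup>* i\<close>. The planes of the first kind, with the lattices that they contain, are the elliptic
  curves with periods \<open>\<tau>\<close> and \<open>1 / d i\<close>; they are isogenous to each other. The second kind spans the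
  complementary Lagrangian sublattice, which the pairing identifies with the dual of the product \<open>E\<close>
  of these curves. This gives the isomorphism \<open>\<alpha>\<close> of lattices, under which the complex structure of
  \<open>E\<close> and its dual is \<open>I_omega\<close> of \<open>\<tau> \<phi>\<close>.

  It remains to recognise the complex structure of \<open>A\<close> and its dual, transported to \<open>E\<close> and its dual,
  as \<open>I_omega\<close> of some \<open>\<omega>E\<close>. For this its upper right block has to be invertible. That block is
  made of the part of \<open>J\<close> that leads from the span \<open>W\<close> of the \<open>f i\<close> to the span of the \<open>e i\<close>, and so the
  condition is that \<open>W\<close> meets \<open>J W\<close> only in zero. This holds for every Lagrangian if \<open>\<phi>\<close> is a polarisation,
  but for indefinite \<open>\<phi>\<close> the basis has to be chosen with care. The theorem
  \<open>ex_symplectic_basis_transversal\<close> does this by choosing each \<open>f i\<close> nonisotropic for the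
  hermitian form of \<open>\<phi>\<close> and passing to the symplectic reduction along it, which carries an
  induced complex structure.

  Finally, \<open>\<omega>E\<close> must lie in the real span of the Neron-Severi group, which for curves
  without complex multiplication is smaller than the space of all invariant forms. The blocks of \<open>J\<close>
  are real matrices acting on \<open>z\<close> coordinatewise, and their symmetry properties make both components of \<open>\<omega>E\<close>
  imaginary parts of hermitian forms with real symmetric matrices; these are real combinations of
  integral forms by \<open>form_of_mem_NS_R\<close>.
\<close>

section \<open>Symplectic lattice bases with a transversal Lagrangian\<close>

text \<open>The data that survive the inductive step: a lattice with an integral symplectic form and a
compatible complex structure on its real span. The subgroup \<open>G\<close> is discrete because the form is
integral and nondegenerate. All conditions on \<open>J\<close> concern the span of
\<open>G\<close> only, so that sublattices can be treated inside the same ambient space.\<close>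

locale hermitian_lattice =
  fixes \<phi> :: "'v::euclidean_space form" and G :: "'v set" and J :: "'v \<Rightarrow> 'v"
  assumes zero_mem: "0 \<in> G"
    and diff_mem: "x \<in> G \<Longrightarrow> y \<in> G \<Longrightarrow> x - y \<in> G"
    and skew: "\<phi> x y = - \<phi> y x"
    and integral: "x \<in> G \<Longrightarrow> y \<in> G \<Longrightarrow> \<phi> x y \<in> \<int>"
    and nondeg: "x \<in> span G \<Longrightarrow> (\<And>y. y \<in> G \<Longrightarrow> \<phi> x y = 0) \<Longrightarrow> x = 0"
    and linear_J: "linear J"
    and J_span: "x \<in> span G \<Longrightarrow> J x \<in> span G"
    and J_J: "x \<in> span G \<Longrightarrow> J (J x) = - x"
    and J_isom: "x \<in> span G \<Longrightarrow> y \<in> span G \<Longrightarrow> \<phi> (J x) (J y) = \<phi> x y"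
begin

lemma alt [simp]: "\<phi> x x = 0"
  using skew[of x x] by simp

lemma uminus_mem: "x \<in> G \<Longrightarrow> - x \<in> G"
  using diff_mem[OF zero_mem, of x] by simp

lemma add_mem: "x \<in> G \<Longrightarrow> y \<in> G \<Longrightarrow> x + y \<in> G"
  using diff_mem[of x "- y"] uminus_mem by simp

lemma of_nat_mem: "x \<in> G \<Longrightarrow> of_nat k *\<^sub>R x \<in> G"
  by (induction k) (auto simp: zero_mem scaleR_left.add intro: add_mem)

lemma of_int_mem: "x \<in> G \<Longrightarrow> of_int k *\<^sub>R x \<in> G"
  by (cases k rule: int_cases2) (auto intro: of_nat_mem uminus_mem)

lemma sum_mem: "(\<And>i. i \<in> I \<Longrightarrow> x i \<in> G) \<Longrightarrow> (\<Sum>i\<in>I. x i) \<in> G"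
  by (induction I rule: infinite_finite_induct) (auto simp: zero_mem intro: add_mem)

lemma vanish_on_span: "x \<in> span S \<Longrightarrow> (\<And>z. z \<in> S \<Longrightarrow> \<phi> u z = 0) \<Longrightarrow> \<phi> u x = 0"
  by (induction x rule: span_induct_alt) (simp_all add: blinfun.add_right blinfun.scaleR_right)

text \<open>The pairing of \<open>x\<close> with \<open>J y\<close> is the real part of the hermitian form whose imaginary part is
\<open>\<phi>\<close>. It may be indefinite; a Lagrangian \<open>W\<close> meets \<open>J W\<close> trivially exactly when this symmetric
form is nondegenerate on \<open>W\<close>.\<close>

lemma g_sym:
  assumes "x \<in> span G" "y \<in> span G"
  shows "\<phi> x (J y) = \<phi> y (J x)"
proof -
  have "\<phi> x (J y) = \<phi> (J x) (J (J y))"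
    using assms by (simp add: J_isom J_span)
  also have "\<dots> = \<phi> y (J x)"
    using assms by (simp add: J_J blinfun.minus_right) (metis skew)
  finally show ?thesis .
qed

definition least_value :: "int \<Rightarrow> bool" where
  "least_value d \<longleftrightarrow> 0 < d \<and> (\<forall>x\<in>G. \<forall>y\<in>G. \<forall>k. \<phi> x y = of_int k \<longrightarrow> 0 < k \<longrightarrow> d \<le> k)"

text \<open>Division with remainder: a nonzero remainder would itself be a smaller positive value of the form.\<close>

lemma divisible_by_least_value:
  assumes d: "least_value d"
    and x: "x \<in> G" and y: "y \<in> G" "\<phi> x y = of_int d" and z: "z \<in> G"
  obtains k where "\<phi> x z = of_int (k * d)"
proof -
  obtain m where m: "\<phi> x z = of_int m"
    using integral[OF x z] by (auto elim: Ints_cases)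
  have "\<phi> x (z - of_int (m div d) *\<^sub>R y) = of_int (m - m div d * d)"
    by (simp add: m y blinfun.diff_right blinfun.scaleR_right)
  then have "\<phi> x (z - of_int (m div d) *\<^sub>R y) = of_int (m mod d)"
    by (metis minus_div_mult_eq_mod)
  moreover have "z - of_int (m div d) *\<^sub>R y \<in> G"
    by (intro diff_mem of_int_mem z y)
  ultimately have "0 < m mod d \<longrightarrow> d \<le> m mod d"
    using d x unfolding least_value_def by blast
  then have "m mod d = 0"
    using d pos_mod_bound[of d m] pos_mod_sign[of d m] unfolding least_value_def by linarith
  then have "m = (m div d) * d"
    by auto
  with m that show ?thesis
    by metis
qed

lemma ex_least_value:
  assumes "x \<in> G" "x \<noteq> 0"
  obtains d u v where "least_value d" "u \<in> G" "v \<in> G" "\<phi> u v = of_int d"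
proof -
  define S where "S = {n::nat. 0 < n \<and> (\<exists>u\<in>G. \<exists>v\<in>G. \<phi> u v = of_nat n)}"
  obtain y where y: "y \<in> G" "\<phi> x y \<noteq> 0"
    using nondeg[of x] assms span_base by blast
  obtain m where m: "\<phi> x y = of_int m"
    using integral[OF assms(1) y(1)] by (auto elim: Ints_cases)
  have "nat \<bar>m\<bar> \<in> S"
  proof (cases "m > 0")
    case True
    with assms y m show ?thesis unfolding S_def by auto
  next
    case False
    then have "\<phi> x (- y) = of_nat (nat \<bar>m\<bar>)" "0 < nat \<bar>m\<bar>"
      using m y by (auto simp: blinfun.minus_right)
    with assms y uminus_mem show ?thesis unfolding S_def by blast
  qed
  then have L: "(LEAST n. n \<in> S) \<in> S" and le: "\<And>n. n \<in> S \<Longrightarrow> (LEAST n. n \<in> S) \<le> n"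
    by (auto intro: LeastI Least_le)
  from L obtain u v where uv: "u \<in> G" "v \<in> G" "\<phi> u v = of_int (int (LEAST n. n \<in> S))"
    "0 < int (LEAST n. n \<in> S)"
    unfolding S_def by auto
  have "int (LEAST n. n \<in> S) \<le> k" if "x \<in> G" "y \<in> G" "\<phi> x y = of_int k" "0 < k" for x y k
  proof -
    from that have "nat k \<in> S"
      unfolding S_def by force
    from le[OF this] \<open>0 < k\<close> show ?thesis
      by linarith
  qed
  with uv(4) have "least_value (int (LEAST n. n \<in> S))"
    unfolding least_value_def by blast
  from that[OF this uv(1-3)] show ?thesis .
qed

text \<open>The partner \<open>f\<close> of \<open>e\<close> may be changed by any lattice vector orthogonal to \<open>e\<close>. If the symmetric
form vanished on all these partners, then polarisation along \<open>f + z\<close> and \<open>f - z\<close> would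
make it vanish on the whole lattice, contradicting \<open>\<phi> e f \<noteq> 0\<close>.\<close>

lemma ex_nonisotropic:
  assumes d: "d > 0" and e: "e \<in> G" and f: "f \<in> G" "\<phi> e f = of_int d"
    and div: "\<And>z. z \<in> G \<Longrightarrow> \<exists>k. \<phi> e z = of_int (k * d)"
  obtains f' where "f' \<in> G" "\<phi> e f' = of_int d" "\<phi> f' (J f') \<noteq> 0"
proof -
  have False if iso: "\<And>x. x \<in> G \<Longrightarrow> \<phi> e x = of_int d \<Longrightarrow> \<phi> x (J x) = 0"
  proof -
    note bil = blinfun.add_right blinfun.add_left blinfun.diff_right blinfun.diff_left
      blinfun.scaleR_right blinfun.scaleR_left linear_add[OF linear_J] linear_diff[OF linear_J]
      linear_scale[OF linear_J]
    have sq: "\<phi> x (J x) = 0" if x: "x \<in> G" for x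
    proof -
      obtain k where k: "\<phi> e x = of_int (k * d)"
        using div[OF x] by blast
      define z where "z = x - of_int k *\<^sub>R f"
      have z: "z \<in> G" "\<phi> e z = 0"
        unfolding z_def using x f k by (auto intro: diff_mem of_int_mem simp: bil)
      have sym: "\<phi> z (J f) = \<phi> f (J z)"
        using z f by (intro g_sym span_base)
      have ff: "\<phi> f (J f) = 0"
        using iso f by blast
      have "\<phi> e (f + z) = of_int d" "\<phi> e (f - z) = of_int d"
        using z f by (auto simp: bil)
      then have "\<phi> (f + z) (J (f + z)) = 0" "\<phi> (f - z) (J (f - z)) = 0"
        using z f by (metis iso add_mem, metis iso diff_mem)
      then have fz: "\<phi> f (J z) = 0" and zz: "\<phi> z (J z) = 0"
        using ff sym by (auto simp: bil)
      have "x = of_int k *\<^sub>R f + z"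
        by (simp add: z_def)
      then show ?thesis
        using ff fz zz sym by (simp add: bil)
    qed
    have pol: "\<phi> x (J y) = 0" if "x \<in> G" "y \<in> G" for x y
      using sq[OF add_mem[OF that]] sq[OF that(1)] sq[OF that(2)]
        g_sym[OF span_base[OF that(1)] span_base[OF that(2)]] by (simp add: bil)
    have ext: "\<phi> x (J y) = 0" if "x \<in> G" "y \<in> span G" for x y
      using that(2)
      by (induction y rule: span_induct_alt)
        (simp_all add: bil pol that(1) linear_0[OF linear_J])
    have "\<phi> e (J (J f)) = 0"
      using e f by (intro ext J_span span_base)
    then show False
      using f d J_J[OF span_base[OF f(1)]] by (simp add: blinfun.minus_right)
  qed
  with that show ?thesis
    by blast
qed


text \<open>A hyperbolic plane on which the form takes its least positive value splits off as a direct summand,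
because all pairings with \<open>e\<close> and \<open>f\<close> are divisible by that value.\<close>

lemma decompose_mem:
  assumes d: "least_value d"
    and e: "e \<in> G" and f: "f \<in> G" and ef: "\<phi> e f = of_int d" and u: "u \<in> G"
  obtains k l z where "z \<in> G" "\<phi> e z = 0" "\<phi> f z = 0"
    "u = of_int k *\<^sub>R e + of_int l *\<^sub>R f + z"
proof -
  obtain l where l: "\<phi> e u = of_int (l * d)"
    using divisible_by_least_value[OF d e f ef u] by metis
  have fe: "\<phi> f (- e) = of_int d"
    using skew[of f e] ef by (simp add: blinfun.minus_right)
  obtain k where k: "\<phi> f u = of_int (k * d)"
    using divisible_by_least_value[OF d f uminus_mem[OF e] fe u] by metis
  define z where "z = u - of_int (- k) *\<^sub>R e - of_int l *\<^sub>R f"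
  have "z \<in> G"
    unfolding z_def by (intro diff_mem of_int_mem u e f)
  moreover have "\<phi> e z = 0" "\<phi> f z = 0"
    using ef skew[of f e] l k
    by (simp_all add: z_def blinfun.diff_right blinfun.add_right blinfun.scaleR_right)
  moreover have "u = of_int (- k) *\<^sub>R e + of_int l *\<^sub>R f + z"
    by (simp add: z_def)
  ultimately show ?thesis
    by (rule that)
qed

end

text \<open>Symplectic reduction along \<open>f\<close>: the complement \<open>perp\<close> of the hyperbolic plane represents
\<open>f\<^sup>\<bottom> / f\<close>. Since \<open>f\<close> is not isotropic for the hermitian form, this quotient is also
the hermitian complement of the complex line through \<open>f\<close>, and so inherits a complex structure.\<close>

locale hermitian_reduction = hermitian_lattice \<phi> G J
  for \<phi> :: "'v::euclidean_space form" and G J +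
  fixes e f :: 'v and d :: int
  assumes d_least: "least_value d"
    and e_mem: "e \<in> G" and f_mem: "f \<in> G" and ef: "\<phi> e f = of_int d"
    and nonisotropic: "\<phi> f (J f) \<noteq> 0"
begin

definition perp :: "'v set" where
  "perp = {z \<in> G. \<phi> e z = 0 \<and> \<phi> f z = 0}"

text \<open>\<open>t x\<close> is the coefficient that moves \<open>x\<close> along \<open>f\<close> into the hermitian complement of \<open>f\<close>;
\<open>J'\<close> applies \<open>J\<close> there and moves the result back along \<open>f\<close> into the complement of \<open>e\<close>.\<close>

definition t :: "'v \<Rightarrow> real" where
  "t x = \<phi> x (J f) / \<phi> f (J f)"

definition proj :: "'v \<Rightarrow> 'v" where
  "proj x = x - t x *\<^sub>R f"

definition J' :: "'v \<Rightarrow> 'v" where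
  "J' x = J (proj x) - (\<phi> e (J (proj x)) / d) *\<^sub>R f"

lemmas bilin = blinfun.add_right blinfun.add_left blinfun.diff_right blinfun.diff_left
  blinfun.scaleR_right blinfun.scaleR_left linear_add[OF linear_J] linear_diff[OF linear_J]
  linear_scale[OF linear_J]

lemma d_real: "real_of_int d \<noteq> 0"
  using d_least by (simp add: least_value_def)

lemma fe: "\<phi> f e = - of_int d"
  using skew[of f e] ef by simp

lemma linear_J': "linear J'"
proof (rule linearI)
  fix x y c
  have t: "t (x + y) = t x + t y" "t (c *\<^sub>R x) = c * t x"
    by (simp_all add: t_def bilin add_divide_distrib)
  show "J' (x + y) = J' x + J' y" "J' (c *\<^sub>R x) = c *\<^sub>R J' x"
    by (simp_all add: J'_def proj_def t bilin algebra_simps add_divide_distrib diff_divide_distrib)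
qed

lemma perp_span: 
  assumes "x \<in> span perp" shows "x \<in> span G" "\<phi> e x = 0" "\<phi> f x = 0"
  using assms vanish_on_span[OF assms] span_mono[of perp G] by (auto simp: perp_def)

lemma span_eq: "span G = span (insert e (insert f perp))"
proof (rule span_eq[THEN iffD2], intro conjI subsetI)
  fix u assume "u \<in> G"
  from decompose_mem[OF d_least e_mem f_mem ef this]
  obtain k l z where "z \<in> G" "\<phi> e z = 0" "\<phi> f z = 0"
    "u = of_int k *\<^sub>R e + of_int l *\<^sub>R f + z" by metis
  then show "u \<in> span (insert e (insert f perp))"
    by (auto intro!: span_add span_scale intro: span_base simp: perp_def)
next
  fix u assume "u \<in> insert e (insert f perp)"
  then show "u \<in> span G"
    using e_mem f_mem by (auto simp: perp_def intro: span_base)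
qed

lemma span_perpI:
  assumes "x \<in> span G" "\<phi> e x = 0" "\<phi> f x = 0"
  shows "x \<in> span perp"
proof -
  from assms(1) obtain a where "x - a *\<^sub>R e \<in> span (insert f perp)"
    unfolding span_eq by (auto simp: span_breakdown_eq)
  then obtain b where b: "x - a *\<^sub>R e - b *\<^sub>R f \<in> span perp"
    by (auto simp: span_breakdown_eq)
  from perp_span(2,3)[OF b] have "a = 0" "b = 0"
    using assms d_real by (auto simp: bilin ef fe)
  with b show ?thesis
    by simp
qed

lemma f_notin: "f \<notin> span perp" and e_notin: "e \<notin> span (insert f perp)"
proof -
  show "f \<notin> span perp"
    using perp_span(2)[of f] ef d_real by auto
  have "\<phi> f x = 0" if "x \<in> span (insert f perp)" for x
    using that by (rule vanish_on_span) (auto simp: perp_def)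
  then show "e \<notin> span (insert f perp)"
    using fe d_real by force
qed

lemma dim_perp: "dim G = dim perp + 2"
proof -
  have "dim G = dim (span (insert e (insert f perp)))"
    by (metis span_eq dim_span)
  then show ?thesis
    using f_notin e_notin by (simp add: dim_insert)
qed

lemma proj_span:
  assumes "x \<in> span G" shows "proj x \<in> span G"
  using assms f_mem by (auto simp: proj_def intro: span_diff span_scale span_base)

lemma proj_perp: "\<phi> (proj x) (J f) = 0"
  using nonisotropic by (simp add: proj_def t_def bilin)

lemma f_J_proj: "x \<in> span G \<Longrightarrow> \<phi> f (J (proj x)) = 0"
  using proj_perp[of x] g_sym[OF proj_span[of x] span_base[OF f_mem]] by simp

lemma J'_span:
  assumes "x \<in> span G" shows "J' x \<in> span perp"
proof (rule span_perpI)
  show "J' x \<in> span G"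
    using proj_span[OF assms] f_mem by (auto simp: J'_def intro: span_diff span_scale span_base J_span)
  show "\<phi> e (J' x) = 0"
    using d_real by (simp add: J'_def bilin ef)
  show "\<phi> f (J' x) = 0"
    using f_J_proj[OF assms] by (simp add: J'_def bilin)
qed

lemma proj_J':
  assumes x: "x \<in> span perp" shows "proj (J' x) = J (proj x)"
proof -
  note xG = perp_span(1)[OF x]
  have "\<phi> (J (proj x)) (J f) = \<phi> (proj x) f"
    using xG span_base[OF f_mem] by (intro J_isom proj_span)
  also have "\<dots> = 0"
    using perp_span(3)[OF x] skew[of x f] by (simp add: proj_def bilin)
  finally have "t (J' x) = - (\<phi> e (J (proj x)) / d)"
    using nonisotropic by (simp add: t_def J'_def bilin)
  then show ?thesis
    by (simp add: proj_def[of "J' x"]) (simp add: J'_def)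
qed

lemma J'_J':
  assumes x: "x \<in> span perp" shows "J' (J' x) = - x"
proof -
  have "J (J (proj x)) = - proj x"
    using perp_span(1)[OF x] by (intro J_J proj_span)
  then show ?thesis
    using perp_span(2)[OF x] d_real
    by (simp add: J'_def[of "J' x"] proj_J'[OF x] bilin blinfun.minus_right)
      (simp add: proj_def bilin ef)
qed

lemma J'_isom:
  assumes x: "x \<in> span perp" and y: "y \<in> span perp"
  shows "\<phi> (J' x) (J' y) = \<phi> x y"
proof -
  note xG = perp_span(1)[OF x] and yG = perp_span(1)[OF y]
  have "\<phi> (J (proj x)) f = 0"
    using f_J_proj[OF xG] skew[of "J (proj x)" f] by simp
  then have "\<phi> (J' x) (J' y) = \<phi> (J (proj x)) (J (proj y))"
    using f_J_proj[OF yG] by (simp add: J'_def bilin)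
  also have "\<dots> = \<phi> (proj x) (proj y)"
    by (intro J_isom proj_span xG yG)
  also have "\<dots> = \<phi> x y"
    using perp_span(3)[OF x] perp_span(3)[OF y] skew[of x f] by (simp add: proj_def bilin)
  finally show ?thesis .
qed

lemma reduced: "hermitian_lattice \<phi> perp J'"
proof (rule hermitian_lattice.intro)
  show "0 \<in> perp"
    by (simp add: perp_def zero_mem)
  fix x y
  show "\<phi> x y = - \<phi> y x"
    by (rule skew)
  show "x - y \<in> perp" if "x \<in> perp" "y \<in> perp"
    using that by (auto simp: perp_def bilin intro: diff_mem)
  show "\<phi> x y \<in> \<int>" if "x \<in> perp" "y \<in> perp"
    using that by (auto simp: perp_def intro: integral)
  show "linear J'"
    by (rule linear_J')
  show "J' x \<in> span perp" if "x \<in> span perp"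
    using that by (intro J'_span perp_span)
  show "J' (J' x) = - x" if "x \<in> span perp"
    using that by (rule J'_J')
  show "\<phi> (J' x) (J' y) = \<phi> x y" if "x \<in> span perp" "y \<in> span perp"
    using that by (rule J'_isom)
  show "x = 0" if x: "x \<in> span perp" and vanish: "\<And>y. y \<in> perp \<Longrightarrow> \<phi> x y = 0"
  proof (rule nondeg)
    show "x \<in> span G"
      using x by (rule perp_span)
    fix y assume "y \<in> G"
    from decompose_mem[OF d_least e_mem f_mem ef this]
    obtain k l z where z: "z \<in> G" "\<phi> e z = 0" "\<phi> f z = 0"
      "y = of_int k *\<^sub>R e + of_int l *\<^sub>R f + z" by metis
    then show "\<phi> x y = 0"
      using vanish[of z] perp_span[OF x] skew[of x e] skew[of x f]
      by (simp add: bilin perp_def)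
  qed
qed

text \<open>If \<open>w\<close> and \<open>J w\<close> both lie in the extended space, then \<open>w\<close> is hermitian-orthogonal to \<open>f\<close>,
since \<open>f\<close> is \<open>\<phi>\<close>-orthogonal to that space. Hence \<open>w\<close> is the projection of an element of \<open>span S\<close>,
and the claim descends to the reduction.\<close>

lemma transversal_extends:
  assumes S: "S \<subseteq> perp"
    and trans: "\<And>w. w \<in> span S \<Longrightarrow> J' w \<in> span S \<Longrightarrow> w = 0"
    and w: "w \<in> span (insert f S)" and Jw: "J w \<in> span (insert f S)"
  shows "w = 0"
proof -
  have SP: "x \<in> span perp" if "x \<in> span S" for x
    using that S span_mono by blast
  obtain a where w': "w - a *\<^sub>R f \<in> span S"
    using w by (auto simp: span_breakdown_eq)
  obtain b where Jw': "J w - b *\<^sub>R f \<in> span S"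
    using Jw by (auto simp: span_breakdown_eq)
  define x where "x = w - a *\<^sub>R f"
  have xS: "x \<in> span S" and wx: "w = x + a *\<^sub>R f"
    using w' by (simp_all add: x_def)
  note xG = perp_span(1)[OF SP[OF xS]]
  have "w \<in> span G"
    unfolding wx using xG span_base[OF f_mem] by (intro span_add span_scale)
  moreover have "\<phi> f (J w) = 0"
    using perp_span(3)[OF SP[OF Jw']] by (simp add: bilin)
  ultimately have "\<phi> w (J f) = 0"
    using f_mem by (metis g_sym span_base)
  then have "a = - t x"
    using nonisotropic by (simp add: t_def wx bilin field_simps)
  then have wproj: "w = proj x"
    by (simp add: wx proj_def)
  define c where "c = \<phi> e (J (proj x)) / d"
  have J'x: "J' x = (J w - b *\<^sub>R f) + (b - c) *\<^sub>R f"
    by (simp add: J'_def wproj c_def algebra_simps)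
  have "\<phi> e (J' x) = 0"
    by (rule perp_span(2)[OF J'_span[OF xG]])
  then have "b - c = 0"
    unfolding J'x blinfun.add_right perp_span(2)[OF SP[OF Jw']]
    using d_real by (simp add: bilin ef)
  with J'x Jw' have "J' x \<in> span S"
    by simp
  then have "x = 0"
    using trans xS by blast
  then show ?thesis
    using wproj by (simp add: proj_def t_def)
qed

end

text \<open>The Frobenius normal form of an integral symplectic form, without the divisibility chain among the
\<open>d i\<close> but with a Lagrangian span of the \<open>f i\<close> that is transversal to its image under \<open>J\<close>.
When the hermitian form is indefinite, an arbitrary symplectic basis need not have this property: the
\<open>f i\<close> may even span a complex subspace. Hence each \<open>f i\<close> is chosen nonisotropic before the induction
passes to the reduction along it.\<close>

theorem ex_symplectic_basis_transversal:
  fixes \<phi> :: "'v::euclidean_space form"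
  assumes "hermitian_lattice \<phi> G J"
  shows "\<exists>n e f d. dim G = 2 * n \<and> (\<forall>i<n. 0 < (d i :: int)) \<and>
     (\<forall>i<n. \<forall>j<n. \<phi> (e i) (e j) = 0 \<and> \<phi> (f i) (f j) = 0 \<and> \<phi> (e i) (f j) = (if i = j then of_int (d i) else 0)) \<and>
     G = {\<Sum>i<n. of_int (k i) *\<^sub>R e i + of_int (l i) *\<^sub>R f i | k l. True} \<and>
     (\<forall>w \<in> span (f ` {..<n}). J w \<in> span (f ` {..<n}) \<longrightarrow> w = 0)"
  using assms
proof (induction "dim G" arbitrary: G J rule: less_induct)
  case (less G J)
  interpret hermitian_lattice \<phi> G J
    by (rule less.prems)
  show ?case
  proof (cases "G \<subseteq> {0}")
    case True
    then have "G = {0}"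
      using zero_mem by auto
    then show ?thesis
      by (intro exI[of _ 0]) auto
  next
    case False
    then obtain x where "x \<in> G" "x \<noteq> 0"
      by blast
    then obtain d e f0 where d: "least_value d"
      and e: "e \<in> G" and f0: "f0 \<in> G" "\<phi> e f0 = of_int d"
      by (rule ex_least_value)
    have "\<exists>k. \<phi> e z = of_int (k * d)" if "z \<in> G" for z
      using divisible_by_least_value[OF d e f0 that] by metis
    moreover have "0 < d"
      using d by (simp add: least_value_def)
    ultimately obtain f where f: "f \<in> G" "\<phi> e f = of_int d" "\<phi> f (J f) \<noteq> 0"
      using ex_nonisotropic e f0 by metis
    interpret hermitian_reduction \<phi> G J e f d
      by unfold_locales (use d e f in auto)
    have "dim perp < dim G"
      using dim_perp by simp
    from less.hyps[OF this reduced] obtain n e' f' d' where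
      n: "dim perp = 2 * n" and d': "\<forall>i<n. 0 < (d' i :: int)"
      and rel: "\<forall>i<n. \<forall>j<n. \<phi> (e' i) (e' j) = 0 \<and> \<phi> (f' i) (f' j) = 0 \<and>
        \<phi> (e' i) (f' j) = (if i = j then of_int (d' i) else 0)"
      and perp: "perp = {\<Sum>i<n. of_int (k i) *\<^sub>R e' i + of_int (l i) *\<^sub>R f' i | k l. True}"
      and trans: "\<forall>w \<in> span (f' ` {..<n}). J' w \<in> span (f' ` {..<n}) \<longrightarrow> w = 0"
      by blast
    have mem: "e' i \<in> perp \<and> f' i \<in> perp" if i: "i < n" for i
    proof -
      have single: "(\<Sum>j<n. of_int (if j = i then 1 else 0) *\<^sub>R x j) = x i" for x :: "nat \<Rightarrow> 'v"
      proof -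
        have "(\<Sum>j<n. of_int (if j = i then 1 else 0) *\<^sub>R x j) = (\<Sum>j<n. if j = i then x j else 0)"
          by (intro sum.cong) auto
        also have "\<dots> = x i"
          using i by (simp add: sum.delta')
        finally show ?thesis .
      qed
      have eq: "e' i = (\<Sum>j<n. of_int (if j = i then 1 else 0) *\<^sub>R e' j + of_int 0 *\<^sub>R f' j)"
        "f' i = (\<Sum>j<n. of_int 0 *\<^sub>R e' j + of_int (if j = i then 1 else 0) *\<^sub>R f' j)"
        by (simp_all only: of_int_0 scaleR_zero_left add_0_left add_0_right single)
      show ?thesis
        unfolding perp by (intro conjI CollectI exI TrueI, rule eq(1), rule eq(2))
    qed
    have orth: "\<phi> e (e' i) = 0" "\<phi> e (f' i) = 0" "\<phi> f (e' i) = 0" "\<phi> f (f' i) = 0"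
      "\<phi> (e' i) e = 0" "\<phi> (f' i) e = 0" "\<phi> (e' i) f = 0" "\<phi> (f' i) f = 0" if "i < n" for i
      using mem[OF that] skew[of "e' i"] skew[of "f' i"] by (auto simp: perp_def)
    define E F D where "E = e'(n := e)" and "F = f'(n := f)" and "D = d'(n := d)"
    have upd: "(\<Sum>i<Suc n. of_int (k i) *\<^sub>R E i + of_int (l i) *\<^sub>R F i) =
      of_int (k n) *\<^sub>R e + of_int (l n) *\<^sub>R f + (\<Sum>i<n. of_int (k i) *\<^sub>R e' i + of_int (l i) *\<^sub>R f' i)"
      for k l :: "nat \<Rightarrow> int"
      by (simp add: E_def F_def add.commute)
    have "G = {\<Sum>i<Suc n. of_int (k i) *\<^sub>R E i + of_int (l i) *\<^sub>R F i | k l. True}" (is "_ = ?R")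
    proof (intro equalityI subsetI)
      fix u assume "u \<in> G"
      from decompose_mem[OF d e f(1,2) this]
      obtain a b z where z: "z \<in> G" "\<phi> e z = 0" "\<phi> f z = 0"
        "u = of_int a *\<^sub>R e + of_int b *\<^sub>R f + z" by metis
      then have "z \<in> perp"
        by (simp add: perp_def)
      then obtain k l where kl: "z = (\<Sum>i<n. of_int (k i) *\<^sub>R e' i + of_int (l i) *\<^sub>R f' i)"
        unfolding perp by blast
      have "u = (\<Sum>i<Suc n. of_int ((k(n := a)) i) *\<^sub>R E i + of_int ((l(n := b)) i) *\<^sub>R F i)"
        unfolding upd by (simp add: z kl)
      then show "u \<in> ?R"
        by blast
    next
      fix u assume "u \<in> ?R"
      then obtain k l where u: "u = (\<Sum>i<Suc n. of_int (k i) *\<^sub>R E i + of_int (l i) *\<^sub>R F i)"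
        by blast
      have "E i \<in> G \<and> F i \<in> G" if "i < Suc n" for i
        using that mem[of i] e f by (auto simp: E_def F_def perp_def)
      then show "u \<in> G"
        unfolding u by (intro sum_mem add_mem of_int_mem) auto
    qed
    moreover have "\<forall>i<Suc n. \<forall>j<Suc n. \<phi> (E i) (E j) = 0 \<and> \<phi> (F i) (F j) = 0 \<and>
        \<phi> (E i) (F j) = (if i = j then of_int (D i) else 0)"
      using rel orth f(2) by (auto simp: E_def F_def D_def less_Suc_eq)
    moreover have "\<forall>i<Suc n. 0 < D i"
      using d' \<open>0 < d\<close> by (auto simp: D_def less_Suc_eq)
    moreover have "dim G = 2 * Suc n"
      using dim_perp n by simp
    moreover have "F ` {..<Suc n} = insert f (f' ` {..<n})"
      by (auto simp: F_def lessThan_Suc)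
    moreover have "w = 0" if "w \<in> span (insert f (f' ` {..<n}))" "J w \<in> span (insert f (f' ` {..<n}))" for w
      by (rule transversal_extends[OF _ _ that]) (use mem trans in auto)
    ultimately show ?thesis
      by (intro exI[of _ "Suc n"] exI[of _ E] exI[of _ F] exI[of _ D]) auto
  qed
qed

section \<open>Lattices, products of tori and elliptic curves\<close>

lemma full_lattice_diff:
  assumes "full_lattice \<Gamma>" "x \<in> \<Gamma>" "y \<in> \<Gamma>"
  shows "x - y \<in> \<Gamma>"
proof -
  obtain B where \<Gamma>: "\<Gamma> = {(\<Sum>b\<in>B. of_int (k b) *\<^sub>R b) | k. True}"
    using assms(1) by (auto simp: full_lattice_def)
  obtain k l where "x = (\<Sum>b\<in>B. of_int (k b) *\<^sub>R b)" "y = (\<Sum>b\<in>B. of_int (l b) *\<^sub>R b)"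
    using assms(2,3) unfolding \<Gamma> by blast
  then have "x - y = (\<Sum>b\<in>B. of_int (k b - l b) *\<^sub>R b)"
    by (simp add: sum_subtractf algebra_simps)
  then show ?thesis
    unfolding \<Gamma> by (intro CollectI exI conjI TrueI)
qed

lemma full_lattice_zero:
  assumes "full_lattice \<Gamma>"
  shows "0 \<in> \<Gamma>"
proof -
  obtain B where \<Gamma>: "\<Gamma> = {(\<Sum>b\<in>B. of_int (k b) *\<^sub>R b) | k. True}"
    using assms by (auto simp: full_lattice_def)
  have "0 = (\<Sum>b\<in>B. of_int 0 *\<^sub>R b)"
    by simp
  then show ?thesis
    unfolding \<Gamma> by (intro CollectI exI conjI TrueI)
qed

lemma full_lattice_span:
  assumes "full_lattice \<Gamma>"
  shows "span \<Gamma> = UNIV"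
proof -
  obtain B where B: "finite B" "span B = UNIV" "\<Gamma> = {(\<Sum>b\<in>B. of_int (k b) *\<^sub>R b) | k. True}"
    using assms by (auto simp: full_lattice_def)
  have "b \<in> \<Gamma>" if "b \<in> B" for b
  proof -
    have "b = (\<Sum>c\<in>B. if c = b then c else 0)"
      using that B(1) by simp
    also have "\<dots> = (\<Sum>c\<in>B. of_int (if c = b then 1 else 0) *\<^sub>R c)"
      by (rule sum.cong) auto
    finally have eq: "b = (\<Sum>c\<in>B. of_int (if c = b then 1 else 0) *\<^sub>R c)" .
    show ?thesis
      unfolding B(3) by (intro CollectI exI conjI TrueI, rule eq)
  qed
  then have "span B \<subseteq> span \<Gamma>"
    by (intro span_mono subsetI)
  with B(2) show ?thesis
    by blast
qed

text \<open>A basis of the product lattice consists of the basis vectors of the factors, placed on the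
coordinate axes.\<close>

lemma complex_torus_prod:
  fixes E :: "'n::finite \<Rightarrow> 'v::real_normed_vector ctorus"
  assumes "\<And>i. complex_torus (E i)"
  shows "complex_torus (prod_torus E)"
proof -
  have "\<forall>i. \<exists>B. finite B \<and> independent B \<and> span B = UNIV \<and>
      periods (E i) = {(\<Sum>b\<in>B. of_int (k b) *\<^sub>R b) | k. True}"
    using assms by (auto simp: complex_torus_def full_lattice_def)
  from choice[OF this] obtain B where
    B: "\<forall>i. finite (B i) \<and> independent (B i) \<and> span (B i) = UNIV \<and>
      periods (E i) = {(\<Sum>b\<in>B i. of_int (k b) *\<^sub>R b) | k. True}" ..
  have fin: "finite (B i)" and ind: "independent (B i)" and sp: "span (B i) = UNIV"
    and per: "periods (E i) = {(\<Sum>b\<in>B i. of_int (k b) *\<^sub>R b) | k. True}" for i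
    using B by blast+
  define C where "C = (\<Union>i. axis i ` B i)"
  have nz: "0 \<notin> B i" for i
    using ind dependent_zero by blast
  have finC: "finite C"
    unfolding C_def using fin by simp
  have comp: "(\<Sum>x\<in>C. u x *\<^sub>R x) $ i = (\<Sum>b\<in>B i. u (axis i b) *\<^sub>R b)" for u i
  proof -
    have "(\<Sum>x\<in>C. u x *\<^sub>R x) $ i = (\<Sum>x\<in>C. u x *\<^sub>R (x $ i))"
      by simp
    also have "\<dots> = (\<Sum>x\<in>axis i ` B i. u x *\<^sub>R (x $ i))"
    proof (rule sum.mono_neutral_right)
      show "\<forall>x\<in>C - axis i ` B i. u x *\<^sub>R (x $ i) = 0"
      proof
        fix x assume "x \<in> C - axis i ` B i"
        then obtain j b where "x = axis j b" "j \<noteq> i"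
          by (auto simp: C_def)
        then show "u x *\<^sub>R (x $ i) = 0"
          by (simp add: axis_def)
      qed
    qed (use finC in \<open>auto simp: C_def\<close>)
    also have "\<dots> = (\<Sum>b\<in>B i. u (axis i b) *\<^sub>R b)"
    proof (subst sum.reindex)
      show "inj_on (axis i) (B i)"
        by (auto simp: inj_on_def axis_eq_axis)
    qed (simp add: axis_def)
    finally show ?thesis .
  qed
  \<comment> \<open>A basis vector is nonzero, so it remembers the axis on which it lies.\<close>
  define idx where "idx x = (SOME i. x $ i \<noteq> 0)" for x :: "'v ^ 'n"
  have idx: "idx (axis i b) = i" if "b \<in> B i" for i b
  proof -
    have "(axis i b $ j \<noteq> 0) = (j = i)" for j
      using nz that by (auto simp: axis_def)
    then show ?thesis
      by (simp add: idx_def)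
  qed
  have build: "z = (\<Sum>x\<in>C. k (idx x) (x $ idx x) *\<^sub>R x)"
    if "\<And>i. z $ i = (\<Sum>b\<in>B i. k i b *\<^sub>R b)" for z k
    unfolding vec_eq_iff
  proof
    fix i
    have "(\<Sum>x\<in>C. k (idx x) (x $ idx x) *\<^sub>R x) $ i =
        (\<Sum>b\<in>B i. k (idx (axis i b)) (axis i b $ idx (axis i b)) *\<^sub>R b)"
      by (rule comp)
    also have "\<dots> = z $ i"
      unfolding that by (rule sum.cong) (simp_all add: idx axis_nth)
    finally show "z $ i = (\<Sum>x\<in>C. k (idx x) (x $ idx x) *\<^sub>R x) $ i"
      by (rule sym)
  qed
  have "independent C"
  proof
    assume "dependent C"
    then obtain u v where u: "v \<in> C" "u v \<noteq> 0" "(\<Sum>x\<in>C. u x *\<^sub>R x) = 0"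
      using dependent_finite[OF finC] by blast
    then obtain i b where v: "v = axis i b" "b \<in> B i"
      by (auto simp: C_def)
    have "(\<Sum>b\<in>B i. u (axis i b) *\<^sub>R b) = 0"
      using comp[of u i] u(3) by simp
    then have "\<exists>r. (\<exists>b\<in>B i. r b \<noteq> 0) \<and> (\<Sum>b\<in>B i. r b *\<^sub>R b) = 0"
      using u(2) v by (intro exI[of _ "\<lambda>b. u (axis i b)"]) blast
    then have "dependent (B i)"
      unfolding dependent_finite[OF fin[of i]] by blast
    with ind show False
      by blast
  qed
  moreover have "span C = UNIV"
  proof -
    have "z \<in> span C" for z
    proof -
      have "\<forall>i. \<exists>u. z $ i = (\<Sum>b\<in>B i. u b *\<^sub>R b)"
      proof
        fix i
        have "z $ i \<in> range (\<lambda>u. \<Sum>b\<in>B i. u b *\<^sub>R b)"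
          using sp[of i] by (simp add: span_finite[OF fin])
        then show "\<exists>u. z $ i = (\<Sum>b\<in>B i. u b *\<^sub>R b)"
          by blast
      qed
      from choice[OF this] obtain k where "\<And>i. z $ i = (\<Sum>b\<in>B i. k i b *\<^sub>R b)"
        by blast
      from build[OF this] show ?thesis
        by (simp only:) (intro span_sum span_scale span_base)
    qed
    then show ?thesis
      by blast
  qed
  moreover have "periods (prod_torus E) = {(\<Sum>x\<in>C. of_int (k x) *\<^sub>R x) | k. True}"
  proof (intro equalityI subsetI)
    fix z assume "z \<in> periods (prod_torus E)"
    then have "\<forall>i. \<exists>k. z $ i = (\<Sum>b\<in>B i. of_int (k b) *\<^sub>R b)"
      by (auto simp: prod_torus_def per)
    from choice[OF this] obtain k where "\<And>i. z $ i = (\<Sum>b\<in>B i. of_int (k i b) *\<^sub>R b)"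
      by blast
    from build[OF this] show "z \<in> {(\<Sum>x\<in>C. of_int (k x) *\<^sub>R x) | k. True}"
      by (intro CollectI exI[of _ "\<lambda>x. k (idx x) (x $ idx x)"]) simp
  next
    fix z assume "z \<in> {(\<Sum>x\<in>C. of_int (k x) *\<^sub>R x) | k. True}"
    then obtain k where "z = (\<Sum>x\<in>C. of_int (k x) *\<^sub>R x)"
      by blast
    then show "z \<in> periods (prod_torus E)"
      by (auto simp only: prod_torus_def ctorus.simps comp per mem_Collect_eq)
  qed
  ultimately have "full_lattice (periods (prod_torus E))"
    unfolding full_lattice_def using finC by blast
  moreover have "cstruct (prod_torus E) o\<^sub>L cstruct (prod_torus E) = - id_blinfun"
  proof (rule blinfun_eqI)
    fix z
    have "cstruct (E i) (cstruct (E i) (z $ i)) = - z $ i" for i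
    proof -
      have "(cstruct (E i) o\<^sub>L cstruct (E i)) (z $ i) = (- id_blinfun) (z $ i)"
        using assms[of i] by (simp add: complex_torus_def)
      then show ?thesis
        by (simp add: blinfun.minus_left)
    qed
    then show "(cstruct (prod_torus E) o\<^sub>L cstruct (prod_torus E)) z = (- id_blinfun) z"
      by (simp add: vec_eq_iff cstruct_prod_torus blinfun.minus_left)
  qed
  ultimately show ?thesis
    by (simp add: complex_torus_def)
qed

definition curve :: "complex \<Rightarrow> int \<Rightarrow> complex ctorus" where
  "curve \<tau> c = \<lparr>periods = {of_int k * \<tau> + of_int l / of_int c | k l. True},
                cstruct = blinfun_mult_right \<i>\<rparr>"

text \<open>Writing \<open>z = y * \<tau> - s\<close> with real \<open>y\<close> and \<open>s\<close>, the coordinates are \<open>y = Im z / Im \<tau>\<close> and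
\<open>s = Re \<tau> * y - Re z\<close>.\<close>

lemma mem_periods_curve:
  assumes "Im \<tau> \<noteq> 0" "c \<noteq> 0"
  shows "z \<in> periods (curve \<tau> c) \<longleftrightarrow>
    Im z / Im \<tau> \<in> \<int> \<and> of_int c * (Re \<tau> * (Im z / Im \<tau>) - Re z) \<in> \<int>" (is "_ \<longleftrightarrow> ?r")
proof
  assume "z \<in> periods (curve \<tau> c)"
  then obtain k l where z: "z = of_int k * \<tau> + of_int l / of_int c"
    by (auto simp: curve_def)
  have "Im z / Im \<tau> = of_int k" "of_int c * (Re \<tau> * (Im z / Im \<tau>) - Re z) = - of_int l"
    using assms by (simp_all add: z field_simps Re_divide Im_divide power2_eq_square)
  then show ?r
    by simp
next
  assume ?r
  then obtain k l where k: "Im z / Im \<tau> = of_int k"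
    and l: "of_int c * (Re \<tau> * (Im z / Im \<tau>) - Re z) = of_int l"
    by (metis Ints_cases)
  have "z = of_int k * \<tau> + of_int (- l) / of_int c"
    using assms k l by (simp add: complex_eq_iff field_simps Re_divide Im_divide power2_eq_square)
  then show "z \<in> periods (curve \<tau> c)"
    unfolding curve_def ctorus.simps by blast
qed

lemma elliptic_curve_curve:
  assumes "Im \<tau> \<noteq> 0" "c \<noteq> 0"
  shows "elliptic_curve (curve \<tau> c)"
proof -
  define u where "u = (1 / of_int c :: complex)"
  have u: "Im u = 0" "Re u \<noteq> 0" "Im u \<noteq> Im \<tau>"
    using assms by (simp_all add: u_def Re_divide Im_divide power2_eq_square)
  have ne: "u \<noteq> \<tau>"
    using u by auto
  have sum: "(\<Sum>b\<in>{\<tau>, u}. r b *\<^sub>R b) = r \<tau> *\<^sub>R \<tau> + r u *\<^sub>R u" for r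
    using ne by auto
  have "independent {\<tau>, u}"
  proof
    assume "dependent {\<tau>, u}"
    then obtain r where "r \<tau> *\<^sub>R \<tau> + r u *\<^sub>R u = 0" "r \<tau> \<noteq> 0 \<or> r u \<noteq> 0"
      using dependent_finite[of "{\<tau>, u}"] unfolding sum by auto
    then show False
      using u assms by (auto simp: complex_eq_iff)
  qed
  moreover have "span {\<tau>, u} = UNIV"
  proof -
    have "z \<in> span {\<tau>, u}" for z
    proof -
      have "z = (Im z / Im \<tau>) *\<^sub>R \<tau> + ((Re z - Im z / Im \<tau> * Re \<tau>) / Re u) *\<^sub>R u"
        using u assms by (simp add: complex_eq_iff)
      then show ?thesis
        by (metis insertI1 insertI2 span_add span_base span_scale)
    qed
    then show ?thesis
      by blast
  qed
  moreover have "periods (curve \<tau> c) = {(\<Sum>b\<in>{\<tau>, u}. of_int (k b) *\<^sub>R b) | k. True}"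
  proof (intro equalityI subsetI)
    fix z assume "z \<in> periods (curve \<tau> c)"
    then obtain k l where "z = of_int k * \<tau> + of_int l / of_int c"
      by (auto simp: curve_def)
    then have "z = (\<Sum>b\<in>{\<tau>, u}. of_int (if b = u then l else k) *\<^sub>R b)"
      unfolding sum using ne by (auto simp: u_def scaleR_conv_of_real)
    then show "z \<in> {(\<Sum>b\<in>{\<tau>, u}. of_int (k b) *\<^sub>R b) | k. True}"
      by (intro CollectI exI[of _ "\<lambda>b. if b = u then l else k"]) simp
  next
    fix z assume "z \<in> {(\<Sum>b\<in>{\<tau>, u}. of_int (k b) *\<^sub>R b) | k. True}"
    then obtain k where "z = (\<Sum>b\<in>{\<tau>, u}. of_int (k b) *\<^sub>R b)"
      by blast
    then have "z = of_int (k \<tau>) * \<tau> + of_int (k u) / of_int c"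
      unfolding sum by (simp add: u_def scaleR_conv_of_real)
    then show "z \<in> periods (curve \<tau> c)"
      unfolding curve_def ctorus.simps by blast
  qed
  ultimately have "full_lattice (periods (curve \<tau> c))"
    unfolding full_lattice_def by (intro exI[of _ "{\<tau>, u}"]) auto
  moreover have "cstruct (curve \<tau> c) o\<^sub>L cstruct (curve \<tau> c) = - id_blinfun"
    by (rule blinfun_eqI) (simp add: curve_def blinfun.minus_left)
  ultimately show ?thesis
    by (simp add: elliptic_curve_def complex_torus_def torus_dim_def dim_UNIV)
qed

text \<open>Multiplication by \<open>c\<close> sends \<open>1 / c\<close> to \<open>1\<close>, a period of every such curve. A point of the kernel
is congruent modulo the periods to \<open>k * \<tau> / c + l / (c * c')\<close> with \<open>0 \<le> k < c\<close> and \<open>0 \<le> l < c'\<close>.\<close>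

lemma isogenous_curve:
  assumes c: "c > 0" "c' > 0"
  shows "isogenous (curve \<tau> c) (curve \<tau> c')"
proof -
  define h where "h = blinfun_mult_right (of_int c :: complex)"
  have h [simp]: "h x = of_int c * x" for x
    by (simp add: h_def)
  have c0: "(of_int c :: complex) \<noteq> 0" "(of_int c' :: complex) \<noteq> 0"
    using c by auto
  define P where "P = periods (curve \<tau> c)"
  have P: "of_int k * \<tau> + of_int l / of_int c \<in> P" for k l
    unfolding P_def curve_def ctorus.simps by blast
  have P_diff: "x - y \<in> P" if xy: "x \<in> P" "y \<in> P" for x y
  proof -
    obtain k l k' l' where "x = of_int k * \<tau> + of_int l / of_int c" "y = of_int k' * \<tau> + of_int l' / of_int c"
      using xy by (auto simp: P_def curve_def)
    then have "x - y = of_int (k - k') * \<tau> + of_int (l - l') / of_int c"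
      by (simp add: algebra_simps diff_divide_distrib)
    with P[of "k - k'" "l - l'"] show ?thesis
      by (simp only:)
  qed
  have P_0: "0 \<in> P"
    using P[of 0 0] by simp
  have P_minus: "- x \<in> P" if "x \<in> P" for x
    using P_diff[OF P_0 that] by simp
  have P_add: "x + y \<in> P" if "x \<in> P" "y \<in> P" for x y
    using P_diff[OF that(1) P_minus[OF that(2)]] by simp
  define r where "r = {(x, y). x - y \<in> P}"
  have class_eq: "r `` {x} = r `` {y}" if "x - y \<in> P" for x y
  proof -
    have "x - z \<in> P \<longleftrightarrow> y - z \<in> P" for z
      using P_add[OF that, of "y - z"] P_diff[of "x - z" "x - y"] that by (auto simp: algebra_simps)
    then show ?thesis
      by (auto simp: r_def)
  qed
  have "h \<in> torus_hom (curve \<tau> c) (curve \<tau> c')"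
    unfolding torus_hom_def
  proof (intro CollectI conjI ballI)
    fix x assume "x \<in> periods (curve \<tau> c)"
    then obtain k l where "x = of_int k * \<tau> + of_int l / of_int c"
      by (auto simp: curve_def)
    then have "h x = of_int (c * k) * \<tau> + of_int (c' * l) / of_int c'"
      using c0 by (simp add: algebra_simps)
    then show "h x \<in> periods (curve \<tau> c')"
      unfolding curve_def ctorus.simps by blast
  next
    show "h o\<^sub>L cstruct (curve \<tau> c) = cstruct (curve \<tau> c') o\<^sub>L h"
      by (rule blinfun_eqI) (simp add: curve_def)
  qed
  moreover have "\<exists>x. y - h x \<in> periods (curve \<tau> c')" for y
    using c0 by (intro exI[of _ "y / of_int c"]) (auto simp: curve_def intro!: exI[of _ 0])
  moreover have "finite ({x. h x \<in> periods (curve \<tau> c')} // r)"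
  proof (rule finite_subset)
    let ?g = "\<lambda>(k, l). r `` {of_int k * \<tau> / of_int c + of_int l / (of_int c * of_int c')}"
    show "finite (?g ` ({0..<c} \<times> {0..<c'}))"
      by simp
    show "{x. h x \<in> periods (curve \<tau> c')} // r \<subseteq> ?g ` ({0..<c} \<times> {0..<c'})"
    proof
      fix S assume "S \<in> {x. h x \<in> periods (curve \<tau> c')} // r"
      then obtain x where S: "S = r `` {x}" and x: "of_int c * x \<in> periods (curve \<tau> c')"
        by (auto elim!: quotientE)
      from x obtain k l where kl: "of_int c * x = of_int k * \<tau> + of_int l / of_int c'"
        by (auto simp: curve_def)
      have k: "(of_int k :: complex) = of_int (k div c) * of_int c + of_int (k mod c)"
        and l: "(of_int l :: complex) = of_int (l div c') * of_int c' + of_int (l mod c')"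
        by (metis div_mult_mod_eq of_int_add of_int_mult)+
      have "x = (of_int k * \<tau> + of_int l / of_int c') / of_int c"
        using kl c0 by (simp add: field_simps)
      also have "\<dots> = of_int (k mod c) * \<tau> / of_int c + of_int (l mod c') / (of_int c * of_int c') +
          (of_int (k div c) * \<tau> + of_int (l div c') / of_int c)"
        unfolding k l using c0 by (simp add: field_simps)
      finally have "x - (of_int (k mod c) * \<tau> / of_int c + of_int (l mod c') / (of_int c * of_int c')) \<in> P"
        using P[of "k div c" "l div c'"] by simp
      from class_eq[OF this] have "S = ?g (k mod c, l mod c')"
        by (simp add: S)
      moreover have "(k mod c, l mod c') \<in> {0..<c} \<times> {0..<c'}"
        using c by simp
      ultimately show "S \<in> ?g ` ({0..<c} \<times> {0..<c'})"
        by blast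
    qed
  qed
  ultimately show ?thesis
    unfolding isogenous_def isogeny_def r_def P_def by blast
qed

section \<open>Coordinates and forms on a product of elliptic curves\<close>

text \<open>On the product of the curves, a vector is described by real vectors \<open>y\<close> and \<open>s\<close> with
\<open>z = y \<tau> - s\<close>, and a real functional by its values \<open>p\<close> at the units and \<open>q\<close> at \<open>\<tau>\<close> on the axes.
In these coordinates the integers \<open>d i\<close> enter only the period conditions. The complex structure acts on
\<open>(y, s)\<close> and on \<open>(p, q)\<close> by the same real two-by-two matrix, which is also the one by which
\<open>\<tau> \<phi>\<close> acts on the other side of the mirror.\<close>

locale period_coordinates =
  fixes \<tau> :: complex and d :: "'n::finite \<Rightarrow> int"
  assumes Im_nz: "Im \<tau> \<noteq> 0" and d_pos: "\<And>i. d i > 0"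
begin

definition E :: "'n \<Rightarrow> complex ctorus" where
  "E i = curve \<tau> (d i)"

definition vec_of :: "real ^ 'n \<Rightarrow> real ^ 'n \<Rightarrow> complex ^ 'n" where
  "vec_of y s = (\<chi> i. of_real (y $ i) * \<tau> - of_real (s $ i))"

definition yc :: "complex ^ 'n \<Rightarrow> real ^ 'n" where
  "yc z = (\<chi> i. Im (z $ i) / Im \<tau>)"

definition sc :: "complex ^ 'n \<Rightarrow> real ^ 'n" where
  "sc z = (\<chi> i. Re \<tau> * (Im (z $ i) / Im \<tau>) - Re (z $ i))"

definition pc :: "((complex ^ 'n) \<Rightarrow>\<^sub>L real) \<Rightarrow> real ^ 'n" where
  "pc w = (\<chi> i. w (axis i 1))"

definition qc :: "((complex ^ 'n) \<Rightarrow>\<^sub>L real) \<Rightarrow> real ^ 'n" where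
  "qc w = (\<chi> i. w (axis i \<tau>))"

definition covec_of :: "real ^ 'n \<Rightarrow> real ^ 'n \<Rightarrow> (complex ^ 'n) \<Rightarrow>\<^sub>L real" where
  "covec_of p q = Blinfun (\<lambda>z. yc z \<bullet> q - sc z \<bullet> p)"

lemma linear_yc: "linear yc" and linear_sc: "linear sc"
  by (rule linearI; simp add: yc_def sc_def vec_eq_iff algebra_simps add_divide_distrib)+

lemma linear_pc: "linear pc" and linear_qc: "linear qc"
  by (rule linearI; simp add: pc_def qc_def vec_eq_iff blinfun.add_left blinfun.scaleR_left)+

lemmas coord_linear [simp] =
  linear_add[OF linear_yc] linear_add[OF linear_sc] linear_add[OF linear_pc] linear_add[OF linear_qc]
  linear_diff[OF linear_yc] linear_diff[OF linear_sc] linear_diff[OF linear_pc] linear_diff[OF linear_qc]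
  linear_scale[OF linear_yc] linear_scale[OF linear_sc] linear_scale[OF linear_pc] linear_scale[OF linear_qc]

lemma covec_of_apply [simp]: "covec_of p q z = yc z \<bullet> q - sc z \<bullet> p"
proof -
  have "linear (\<lambda>z. yc z \<bullet> q - sc z \<bullet> p)"
    by (rule linearI) (simp_all add: inner_add_left algebra_simps)
  then show ?thesis
    by (simp add: covec_of_def bounded_linear_Blinfun_apply linear_conv_bounded_linear)
qed

lemma vec_of_coords [simp]: "vec_of (yc z) (sc z) = z"
  using Im_nz by (simp add: vec_of_def yc_def sc_def vec_eq_iff complex_eq_iff)

lemma yc_vec_of [simp]: "yc (vec_of y s) = y" and sc_vec_of [simp]: "sc (vec_of y s) = s"
  using Im_nz by (simp_all add: vec_of_def yc_def sc_def vec_eq_iff)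

lemma coords_eqI: "yc z = yc z' \<Longrightarrow> sc z = sc z' \<Longrightarrow> z = z'"
  by (metis vec_of_coords)

lemma coords_axis: "yc (axis i 1) = 0" "sc (axis i 1) = - axis i 1"
  "yc (axis i \<tau>) = axis i 1" "sc (axis i \<tau>) = 0"
  using Im_nz by (auto simp: yc_def sc_def vec_eq_iff axis_def)

lemma pc_covec_of [simp]: "pc (covec_of p q) = p" and qc_covec_of [simp]: "qc (covec_of p q) = q"
  by (simp_all add: pc_def qc_def vec_eq_iff coords_axis inner_axis' )

lemma covec_expand: "blinfun_apply w z = yc z \<bullet> qc w - sc z \<bullet> pc w"
proof -
  have "z = (\<Sum>i\<in>UNIV. yc z $ i *\<^sub>R axis i \<tau> - sc z $ i *\<^sub>R axis i 1)"
  proof (subst vec_of_coords[of z, symmetric], subst vec_eq_iff, rule allI)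
    fix j
    have "(\<Sum>i\<in>UNIV. yc z $ i *\<^sub>R axis i \<tau> - sc z $ i *\<^sub>R axis i 1) $ j =
       (\<Sum>i\<in>UNIV. if i = j then of_real (yc z $ j) * \<tau> - of_real (sc z $ j) else 0)"
      unfolding sum_component by (rule sum.cong) (auto simp: axis_def scaleR_conv_of_real[where 'a = complex])
    then show "vec_of (yc z) (sc z) $ j = (\<Sum>i\<in>UNIV. yc z $ i *\<^sub>R axis i \<tau> - sc z $ i *\<^sub>R axis i 1) $ j"
      by (simp add: vec_of_def)
  qed
  then have "w z = w (\<Sum>i\<in>UNIV. yc z $ i *\<^sub>R axis i \<tau> - sc z $ i *\<^sub>R axis i 1)"
    by (rule arg_cong)
  then show ?thesis
    by (simp add: blinfun.sum_right blinfun.diff_right blinfun.scaleR_right inner_vec_def pc_def qc_def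
        sum_subtractf)
qed

lemma covec_of_coords [simp]: "covec_of (pc w) (qc w) = w"
  by (rule blinfun_eqI) (simp add: covec_expand)

lemma covec_eqI: "pc w = pc w' \<Longrightarrow> qc w = qc w' \<Longrightarrow> w = w'"
  by (metis covec_of_coords)

lemma yc_J: "yc (cstruct (prod_torus E) z) = (Re \<tau> / Im \<tau>) *\<^sub>R yc z - (1 / Im \<tau>) *\<^sub>R sc z"
  and sc_J: "sc (cstruct (prod_torus E) z) =
    (Im \<tau> + (Re \<tau>)\<^sup>2 / Im \<tau>) *\<^sub>R yc z - (Re \<tau> / Im \<tau>) *\<^sub>R sc z"
  using Im_nz
  by (simp_all add: yc_def sc_def vec_eq_iff cstruct_prod_torus E_def curve_def power2_eq_square field_simps)

lemma pc_dual_J: "pc (cstruct (dual_torus (prod_torus E)) w) = (Re \<tau> / Im \<tau>) *\<^sub>R pc w - (1 / Im \<tau>) *\<^sub>R qc w"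
  and qc_dual_J: "qc (cstruct (dual_torus (prod_torus E)) w) =
    (Im \<tau> + (Re \<tau>)\<^sup>2 / Im \<tau>) *\<^sub>R pc w - (Re \<tau> / Im \<tau>) *\<^sub>R qc w"
proof -
  have "cstruct (dual_torus (prod_torus E)) w z =
      - (yc (cstruct (prod_torus E) z) \<bullet> qc w) + sc (cstruct (prod_torus E) z) \<bullet> pc w" for z
    unfolding cstruct_dual_torus by (simp add: blinfun.minus_right covec_expand[of w])
  note J = this
  show "pc (cstruct (dual_torus (prod_torus E)) w) = (Re \<tau> / Im \<tau>) *\<^sub>R pc w - (1 / Im \<tau>) *\<^sub>R qc w"
    "qc (cstruct (dual_torus (prod_torus E)) w) =
    (Im \<tau> + (Re \<tau>)\<^sup>2 / Im \<tau>) *\<^sub>R pc w - (Re \<tau> / Im \<tau>) *\<^sub>R qc w"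
    unfolding pc_def[of "cstruct _ _"] qc_def[of "cstruct _ _"] J
    by (simp_all add: vec_eq_iff yc_J sc_J coords_axis inner_axis' inner_diff_left)
qed

lemma mem_periods_E:
  "z \<in> periods (prod_torus E) \<longleftrightarrow> (\<forall>i. yc z $ i \<in> \<int> \<and> of_int (d i) * sc z $ i \<in> \<int>)"
  using Im_nz d_pos by (simp add: prod_torus_def E_def mem_periods_curve less_imp_neq[symmetric] yc_def sc_def)

lemma mem_periods_dual_E:
  "w \<in> periods (dual_torus (prod_torus E)) \<longleftrightarrow> (\<forall>i. qc w $ i \<in> \<int> \<and> pc w $ i / of_int (d i) \<in> \<int>)"
proof (intro iffI allI conjI)
  fix i
  assume "w \<in> periods (dual_torus (prod_torus E))"
  then have w: "w z \<in> \<int>" if "z \<in> periods (prod_torus E)" for z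
    using that by (simp add: dual_torus_def)
  have "axis i \<tau> \<in> periods (prod_torus E)"
    unfolding mem_periods_E coords_axis by (simp add: axis_def)
  from w[OF this] show "qc w $ i \<in> \<int>"
    by (simp add: qc_def)
  have "(1 / of_int (d i)) *\<^sub>R axis i 1 \<in> periods (prod_torus E)"
    unfolding mem_periods_E coord_linear coords_axis using d_pos[of i] by (auto simp: axis_def)
  from w[OF this] show "pc w $ i / of_int (d i) \<in> \<int>"
    by (simp add: pc_def blinfun.scaleR_right)
next
  assume w: "\<forall>i. qc w $ i \<in> \<int> \<and> pc w $ i / of_int (d i) \<in> \<int>"
  have "w z \<in> \<int>" if z: "z \<in> periods (prod_torus E)" for z
  proof -
    have "sc z $ i * pc w $ i = (of_int (d i) * sc z $ i) * (pc w $ i / of_int (d i))" for i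
      using d_pos[of i] by simp
    then have "w z = (\<Sum>i\<in>UNIV. yc z $ i * qc w $ i - (of_int (d i) * sc z $ i) * (pc w $ i / of_int (d i)))"
      by (simp only: covec_expand[of w z] inner_vec_def inner_real_def sum_subtractf)
    also have "\<dots> \<in> \<int>"
    proof (intro Ints_sum Ints_diff)
      fix i
      show "yc z $ i * qc w $ i \<in> \<int>"
        using w z unfolding mem_periods_E by (blast intro: Ints_mult)
      show "of_int (d i) * sc z $ i * (pc w $ i / of_int (d i)) \<in> \<int>"
        by (rule Ints_mult) (use w z mem_periods_E in blast)+
    qed
    finally show ?thesis .
  qed
  then show "w \<in> periods (dual_torus (prod_torus E))"
    by (simp add: dual_torus_def)
qed

text \<open>For a symmetric real matrix \<open>M\<close> this is, up to the factor \<open>1 / Im \<tau>\<close>, the imaginary part of the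
hermitian form with coefficient matrix \<open>M\<close>.\<close>

definition form_of :: "(real ^ 'n \<Rightarrow> real ^ 'n) \<Rightarrow> (complex ^ 'n) form" where
  "form_of M = Blinfun (\<lambda>z. covec_of (M (yc z)) (M (sc z)))"

lemma form_of:
  assumes "linear M"
  shows "form_of M z = covec_of (M (yc z)) (M (sc z))"
proof -
  have "linear (\<lambda>z. covec_of (M (yc z)) (M (sc z)))"
    using assms by (intro linearI covec_eqI) (simp_all add: linear_add linear_scale)
  then show ?thesis
    by (simp add: form_of_def bounded_linear_Blinfun_apply linear_conv_bounded_linear)
qed

lemma form_of_apply:
  assumes "linear M"
  shows "form_of M z z' = yc z' \<bullet> M (sc z) - sc z' \<bullet> M (yc z)"
  by (simp add: form_of[OF assms])

text \<open>The form is the tensor product of \<open>M\<close> with the determinant in \<open>(y, s)\<close>, and the complex structure acts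
on \<open>(y, s)\<close> by a matrix of determinant one.\<close>

lemma form_of_J:
  assumes "linear M"
  shows "form_of M (cstruct (prod_torus E) z) (cstruct (prod_torus E) z') = form_of M z z'"
proof -
  define r u v where "r = Re \<tau> / Im \<tau>" and "u = 1 / Im \<tau>" and "v = Im \<tau> + (Re \<tau>)\<^sup>2 / Im \<tau>"
  have det: "u * v - r * r = 1"
    using Im_nz by (simp add: r_def u_def v_def field_simps power2_eq_square)
  have "form_of M (cstruct (prod_torus E) z) (cstruct (prod_torus E) z') = (u * v - r * r) * form_of M z z'"
    unfolding form_of_apply[OF assms] yc_J sc_J r_def[symmetric] u_def[symmetric] v_def[symmetric]
    by (simp add: linear_diff[OF assms] linear_scale[OF assms] inner_diff_left inner_diff_right algebra_simps)
  then show ?thesis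
    by (simp add: det)
qed

text \<open>The elementary symmetric matrices \<open>N i j\<close> yield forms that become integral after multiplication by
\<open>d i * d j\<close>, and they span all symmetric matrices.\<close>

lemma form_of_mem_NS_R:
  assumes lin: "linear M" and sym: "\<And>x y. M x \<bullet> y = x \<bullet> M y"
  shows "form_of M \<in> NS_R (prod_torus E)"
proof -
  define N where "N i j x = (x $ i) *\<^sub>R axis j 1 + (x $ j) *\<^sub>R (axis i 1 :: real ^ 'n)" for i j x
  have linN: "linear (N i j)" for i j
    by (rule linearI) (simp_all add: N_def algebra_simps)
  have N_sym: "N i j x \<bullet> y = x \<bullet> N i j y" for i j x y
    by (simp add: N_def inner_axis inner_axis' inner_add_left inner_add_right)
  have NS: "of_int (d i * d j) *\<^sub>R form_of (N i j) \<in> NS (prod_torus E)" for i j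
    unfolding NS_def
  proof (intro CollectI conjI allI ballI)
    fix z z'
    show "(of_int (d i * d j) *\<^sub>R form_of (N i j)) z z' = - (of_int (d i * d j) *\<^sub>R form_of (N i j)) z' z"
      using N_sym[of i j "yc z" "sc z'"] N_sym[of i j "sc z" "yc z'"]
      by (simp add: blinfun.scaleR_left form_of_apply[OF linN] inner_commute algebra_simps)
  next
    fix z z' :: "complex ^ 'n"
    have int: "y \<bullet> N i j s * of_int (d i * d j) \<in> \<int>"
      if "\<And>i. y $ i \<in> \<int>" "\<And>i. of_int (d i) * s $ i \<in> \<int>" for y s
    proof -
      have "y \<bullet> N i j s * of_int (d i * d j) =
        (of_int (d j) * y $ j) * (of_int (d i) * s $ i) + (of_int (d i) * y $ i) * (of_int (d j) * s $ j)"
        by (simp add: N_def inner_axis inner_axis' inner_add_right algebra_simps)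
      also have "\<dots> \<in> \<int>"
        by (rule Ints_add; rule Ints_mult; (rule that | rule Ints_mult[OF Ints_of_int that(1)]))
      finally show ?thesis .
    qed
    assume z: "z \<in> periods (prod_torus E)" "z' \<in> periods (prod_torus E)"
    have "(of_int (d i * d j) *\<^sub>R form_of (N i j)) z z' =
      yc z' \<bullet> N i j (sc z) * of_int (d i * d j) - yc z \<bullet> N i j (sc z') * of_int (d i * d j)"
      using N_sym[of i j "yc z" "sc z'"]
      by (simp add: blinfun.scaleR_left form_of_apply[OF linN] inner_commute algebra_simps)
    also have "\<dots> \<in> \<int>"
      using z unfolding mem_periods_E by (intro Ints_diff int) blast+
    finally show "(of_int (d i * d j) *\<^sub>R form_of (N i j)) z z' \<in> \<int>" .
  next
    fix z z'
    let ?J = "blinfun_apply (cstruct (prod_torus E))"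
    have "form_of (N i j) (?J z) (?J z') = form_of (N i j) z z'"
      by (rule form_of_J[OF linN])
    then show "(of_int (d i * d j) *\<^sub>R form_of (N i j)) (?J z) (?J z') =
        (of_int (d i * d j) *\<^sub>R form_of (N i j)) z z'"
      by (simp add: blinfun.scaleR_left)
  qed
  have mem: "form_of (N i j) \<in> NS_R (prod_torus E)" for i j
  proof -
    have "(1 / of_int (d i * d j)) *\<^sub>R of_int (d i * d j) *\<^sub>R form_of (N i j) \<in> NS_R (prod_torus E)"
      unfolding NS_R_def by (intro span_scale span_base NS)
    then show ?thesis
      using d_pos[of i] d_pos[of j] by simp
  qed
  define m where "m i j = M (axis j 1) $ i" for i j
  have expand: "y \<bullet> M x = (\<Sum>i\<in>UNIV. \<Sum>j\<in>UNIV. (m i j / 2) *\<^sub>R (y \<bullet> N i j x))" for x y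
  proof -
    have M: "M x $ i = (\<Sum>j\<in>UNIV. m i j * x $ j)" for x i
    proof -
      have "x = (\<Sum>j\<in>UNIV. x $ j *\<^sub>R axis j 1)"
        by (metis basis_expansion scalar_mult_eq_scaleR)
      then have "M x $ i = M (\<Sum>j\<in>UNIV. x $ j *\<^sub>R axis j 1) $ i"
        by (rule arg_cong)
      also have "\<dots> = (\<Sum>j\<in>UNIV. m i j * x $ j)"
        by (simp add: linear_sum[OF lin] linear_scale[OF lin] m_def mult.commute)
      finally show ?thesis .
    qed
    have m_sym: "m i j = m j i" for i j
      using sym[of "axis i 1" "axis j 1"] by (simp add: m_def inner_axis inner_axis')
    have "(\<Sum>i\<in>UNIV. \<Sum>j\<in>UNIV. (m i j / 2) *\<^sub>R (y \<bullet> N i j x)) =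
      (\<Sum>i\<in>UNIV. \<Sum>j\<in>UNIV. m i j * x $ i * y $ j) / 2 + (\<Sum>i\<in>UNIV. \<Sum>j\<in>UNIV. m i j * x $ j * y $ i) / 2"
      by (simp add: N_def inner_axis inner_add_right sum.distrib sum_divide_distrib algebra_simps add_divide_distrib)
    also have "(\<Sum>i\<in>UNIV. \<Sum>j\<in>UNIV. m i j * x $ i * y $ j) = (\<Sum>i\<in>UNIV. \<Sum>j\<in>UNIV. m i j * x $ j * y $ i)"
      by (subst sum.swap) (simp add: m_sym)
    also have "(\<Sum>i\<in>UNIV. \<Sum>j\<in>UNIV. m i j * x $ j * y $ i) = y \<bullet> M x"
      by (simp add: inner_vec_def M sum_distrib_left mult_ac)
    finally show ?thesis
      by simp
  qed
  have "form_of M = (\<Sum>i\<in>UNIV. \<Sum>j\<in>UNIV. (m i j / 2) *\<^sub>R form_of (N i j))"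
  proof (intro blinfun_eqI)
    fix z z'
    show "form_of M z z' = (\<Sum>i\<in>UNIV. \<Sum>j\<in>UNIV. (m i j / 2) *\<^sub>R form_of (N i j)) z z'"
      unfolding form_of_apply[OF lin] expand
      by (simp add: blinfun.sum_left blinfun.scaleR_left form_of_apply[OF linN] sum_subtractf algebra_simps)
  qed
  also have "\<dots> \<in> NS_R (prod_torus E)"
    unfolding NS_R_def by (intro span_sum span_scale mem[unfolded NS_R_def])
  finally show ?thesis .
qed

lemma nondegenerate_form_of:
  assumes lin: "linear M" and inj: "\<And>x. M x = 0 \<Longrightarrow> x = 0"
  shows "nondegenerate (form_of M)"
  unfolding nondegenerate_def
proof (intro allI impI)
  fix z assume "\<forall>z'. form_of M z z' = 0"
  then have "form_of M z = 0"
    by (intro blinfun_eqI) simp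
  then have "pc (form_of M z) = 0" "qc (form_of M z) = 0"
    by (simp_all add: linear_0[OF linear_pc] linear_0[OF linear_qc])
  then have "yc z = 0" "sc z = 0"
    using inj by (auto simp: form_of[OF lin])
  then show "z = 0"
    by (intro coords_eqI) (simp_all add: linear_0[OF linear_yc] linear_0[OF linear_sc])
qed

end

section \<open>The mirror isomorphism\<close>

text \<open>The output of the normal form, indexed by the type of the curves. The vectors \<open>e i\<close> together with
\<open>f i / d i\<close> form a standard symplectic frame; \<open>ev\<close> and \<open>fv\<close> are its two halves and
\<open>ec\<close>, \<open>fc\<close> the corresponding coordinates.\<close>

locale transversal_lagrangian_splitting = period_coordinates \<tau> d
  for \<tau> :: complex and d :: "'n::finite \<Rightarrow> int" +
  fixes A :: "'v::euclidean_space ctorus" and \<phi> :: "'v form" and e f :: "'n \<Rightarrow> 'v"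
  assumes torus: "complex_torus A" and \<phi>_NS: "\<phi> \<in> NS A"
    and \<phi>_ee: "\<phi> (e i) (e j) = 0" and \<phi>_ff: "\<phi> (f i) (f j) = 0"
    and \<phi>_ef: "\<phi> (e i) (f j) = (if i = j then of_int (d i) else 0)"
    and periods_A: "periods A = {\<Sum>i\<in>UNIV. of_int (k i) *\<^sub>R e i + of_int (l i) *\<^sub>R f i | k l. True}"
    and transversal: "w \<in> span (range f) \<Longrightarrow> cstruct A w \<in> span (range f) \<Longrightarrow> w = 0"
begin

lemma d_nz [simp]: "d i \<noteq> 0"
  using d_pos[of i] by simp

lemma skew: "\<phi> x y = - \<phi> y x"
  using \<phi>_NS unfolding NS_def by blast

lemma J_isom: "\<phi> (cstruct A x) (cstruct A y) = \<phi> x y"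
  using \<phi>_NS unfolding NS_def by blast

lemma J_J [simp]: "cstruct A (cstruct A x) = - x"
proof -
  have "(cstruct A o\<^sub>L cstruct A) x = (- id_blinfun) x"
    using torus by (simp add: complex_torus_def)
  then show ?thesis
    by (simp add: blinfun.minus_left)
qed

definition ev :: "real ^ 'n \<Rightarrow> 'v" where
  "ev x = (\<Sum>i\<in>UNIV. x $ i *\<^sub>R e i)"

definition fv :: "real ^ 'n \<Rightarrow> 'v" where
  "fv x = (\<Sum>i\<in>UNIV. (x $ i / of_int (d i)) *\<^sub>R f i)"

definition ec :: "'v \<Rightarrow> real ^ 'n" where
  "ec v = (\<chi> i. \<phi> v (f i) / of_int (d i))"

definition fc :: "'v \<Rightarrow> real ^ 'n" where
  "fc v = (\<chi> i. \<phi> (e i) v)"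

lemma linear_ev: "linear ev" and linear_fv: "linear fv"
  by (auto intro!: linearI simp: ev_def fv_def sum.distrib scaleR_sum_right algebra_simps add_divide_distrib)

lemma linear_ec: "linear ec" and linear_fc: "linear fc"
  by (auto intro!: linearI simp: ec_def fc_def vec_eq_iff blinfun.add_left blinfun.add_right
      blinfun.scaleR_left blinfun.scaleR_right add_divide_distrib)

lemmas frame_linear [simp] =
  linear_add[OF linear_ev] linear_add[OF linear_fv] linear_add[OF linear_ec] linear_add[OF linear_fc]
  linear_diff[OF linear_ev] linear_diff[OF linear_fv] linear_diff[OF linear_ec] linear_diff[OF linear_fc]
  linear_neg[OF linear_ev] linear_neg[OF linear_fv] linear_neg[OF linear_ec] linear_neg[OF linear_fc]
  linear_scale[OF linear_ev] linear_scale[OF linear_fv] linear_scale[OF linear_ec] linear_scale[OF linear_fc]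
  linear_0[OF linear_ev] linear_0[OF linear_fv] linear_0[OF linear_ec] linear_0[OF linear_fc]

lemma ec_ev [simp]: "ec (ev x) = x" and fc_ev [simp]: "fc (ev x) = 0"
  by (simp_all add: ec_def fc_def ev_def vec_eq_iff blinfun.sum_left blinfun.sum_right
      blinfun.scaleR_left blinfun.scaleR_right \<phi>_ef \<phi>_ee if_distrib[of "(*) _"] cong: if_cong)

lemma ec_fv [simp]: "ec (fv x) = 0" and fc_fv [simp]: "fc (fv x) = x"
  by (simp_all add: ec_def fc_def fv_def vec_eq_iff blinfun.sum_left blinfun.sum_right
      blinfun.scaleR_left blinfun.scaleR_right \<phi>_ef \<phi>_ff if_distrib[of "(*) _"] cong: if_cong)

lemma frame_expand: "v = ev (ec v) + fv (fc v)"
proof -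
  have "v \<in> span (periods A)"
    using torus by (simp add: complex_torus_def full_lattice_span)
  then show ?thesis
  proof (induction v rule: span_induct_alt)
    case base
    show ?case by simp
  next
    case (step c x y)
    from step(1) obtain k l where x: "x = (\<Sum>i\<in>UNIV. of_int (k i) *\<^sub>R e i + of_int (l i) *\<^sub>R f i)"
      by (auto simp: periods_A)
    have "x = ev (\<chi> i. of_int (k i)) + fv (\<chi> i. of_int (l i) * of_int (d i))"
      by (simp add: x ev_def fv_def sum.distrib)
    then have "x = ev (ec x) + fv (fc x)"
      by simp
    have "ev (ec (c *\<^sub>R x + y)) + fv (fc (c *\<^sub>R x + y)) =
        c *\<^sub>R (ev (ec x) + fv (fc x)) + (ev (ec y) + fv (fc y))"
      by (simp add: algebra_simps)
    also have "\<dots> = c *\<^sub>R x + y"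
      unfolding \<open>x = ev (ec x) + fv (fc x)\<close>[symmetric] step(2)[symmetric] ..
    finally show ?case ..
  qed
qed

lemma frame_eqI: "ec v = ec v' \<Longrightarrow> fc v = fc v' \<Longrightarrow> v = v'"
  by (metis frame_expand)

lemma \<phi>_frame: "\<phi> u v = ec u \<bullet> fc v - fc u \<bullet> ec v"
proof -
  have "\<phi> (ev x) v = x \<bullet> fc v" for x v
    by (simp add: ev_def fc_def inner_vec_def blinfun.sum_left blinfun.sum_right blinfun.scaleR_left
        blinfun.scaleR_right)
  moreover have "\<phi> (fv x) v = - (x \<bullet> ec v)" for x v
    using skew[of "f _" v]
    by (simp add: fv_def ec_def inner_vec_def blinfun.sum_left blinfun.sum_right blinfun.scaleR_left
        blinfun.scaleR_right sum_negf)
  ultimately have "\<phi> (ev (ec u) + fv (fc u)) v = ec u \<bullet> fc v - fc u \<bullet> ec v"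
    by (simp add: blinfun.add_left blinfun.add_right)
  then show ?thesis
    by (simp flip: frame_expand)
qed

definition \<phi>_inv :: "('v \<Rightarrow>\<^sub>L real) \<Rightarrow> 'v" where
  "\<phi>_inv \<eta> = ev (\<chi> i. \<eta> (f i) / of_int (d i)) - fv (\<chi> i. \<eta> (e i))"

lemma \<phi>_\<phi>_inv [simp]: "\<phi> (\<phi>_inv \<eta>) = \<eta>"
proof (rule blinfun_eqI)
  fix v
  have "\<phi> (\<phi>_inv \<eta>) v = \<eta> (ev (ec v) + fv (fc v))"
    unfolding \<phi>_frame[of "\<phi>_inv \<eta>"]
    by (simp add: \<phi>_inv_def ev_def[of "ec v"] fv_def[of "fc v"] inner_vec_def blinfun.sum_right
        blinfun.add_right blinfun.scaleR_right sum.distrib sum_negf mult.commute)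
  then show "\<phi> (\<phi>_inv \<eta>) v = \<eta> v"
    by (simp flip: frame_expand)
qed

lemma \<phi>_eqD: "\<phi> u = \<phi> v \<Longrightarrow> u = v"
  by (rule frame_eqI) (auto simp: ec_def fc_def vec_eq_iff skew[of "e _" u] skew[of "e _" v])

lemma \<phi>_inv_\<phi> [simp]: "\<phi>_inv (\<phi> u) = u"
  by (rule \<phi>_eqD) simp

lemma nondegenerate_\<phi>: "nondegenerate \<phi>"
  unfolding nondegenerate_def
proof (intro allI impI)
  fix v assume "\<forall>w. \<phi> v w = 0"
  then have "\<phi> v = \<phi> 0"
    by (intro blinfun_eqI) (simp add: blinfun.zero_left)
  then show "v = 0"
    by (rule \<phi>_eqD)
qed

lemma mem_periods_A: "v \<in> periods A \<longleftrightarrow> (\<forall>i. ec v $ i \<in> \<int> \<and> fc v $ i / of_int (d i) \<in> \<int>)"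
proof
  assume "v \<in> periods A"
  then obtain k l where v: "v = (\<Sum>i\<in>UNIV. of_int (k i) *\<^sub>R e i + of_int (l i) *\<^sub>R f i)"
    by (auto simp: periods_A)
  have "v = ev (\<chi> i. of_int (k i)) + fv (\<chi> i. of_int (l i) * of_int (d i))"
    by (simp add: v ev_def fv_def sum.distrib)
  then show "\<forall>i. ec v $ i \<in> \<int> \<and> fc v $ i / of_int (d i) \<in> \<int>"
    by simp
next
  assume "\<forall>i. ec v $ i \<in> \<int> \<and> fc v $ i / of_int (d i) \<in> \<int>"
  then have "\<forall>i. (\<exists>k. ec v $ i = of_int k) \<and> (\<exists>l. fc v $ i / of_int (d i) = of_int l)"
    by (auto elim!: Ints_cases)
  then obtain k l where kl: "\<And>i. ec v $ i = of_int (k i)" "\<And>i. fc v $ i / of_int (d i) = of_int (l i)"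
    by metis
  have "v = ev (ec v) + fv (fc v)"
    by (rule frame_expand)
  then have "v = (\<Sum>i\<in>UNIV. of_int (k i) *\<^sub>R e i + of_int (l i) *\<^sub>R f i)"
    by (simp add: ev_def fv_def kl sum.distrib)
  then show "v \<in> periods A"
    unfolding periods_A by blast
qed

lemma mem_periods_dual_A:
  "\<phi> u \<in> periods (dual_torus A) \<longleftrightarrow> (\<forall>i. fc u $ i \<in> \<int> \<and> of_int (d i) * ec u $ i \<in> \<int>)"
proof (intro iffI allI conjI)
  fix i
  assume "\<phi> u \<in> periods (dual_torus A)"
  then have u: "\<phi> u v \<in> \<int>" if "v \<in> periods A" for v
    using that by (simp add: dual_torus_def)
  have "e i = ev (axis i 1)"
    by (simp add: ev_def axis_def if_distrib[of "\<lambda>x. x *\<^sub>R _"] cong: if_cong)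
  then have "e i \<in> periods A"
    by (simp add: mem_periods_A) (simp add: axis_def)
  from u[OF this] show "fc u $ i \<in> \<int>"
    by (simp add: fc_def skew[of "e i" u])
  have "f i = fv (axis i (of_int (d i)))"
    by (simp add: fv_def axis_def if_distrib[of "\<lambda>x. x *\<^sub>R _"] if_distrib[of "\<lambda>x. x / _"] cong: if_cong)
  then have "f i \<in> periods A"
    by (simp add: mem_periods_A) (simp add: axis_def)
  from u[OF this] show "of_int (d i) * ec u $ i \<in> \<int>"
    by (simp add: ec_def)
next
  assume u: "\<forall>i. fc u $ i \<in> \<int> \<and> of_int (d i) * ec u $ i \<in> \<int>"
  have "\<phi> u v \<in> \<int>" if v: "v \<in> periods A" for v
  proof -
    have "ec u $ i * fc v $ i = (of_int (d i) * ec u $ i) * (fc v $ i / of_int (d i))" for i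
      by simp
    then have "\<phi> u v = (\<Sum>i\<in>UNIV. (of_int (d i) * ec u $ i) * (fc v $ i / of_int (d i)) - fc u $ i * ec v $ i)"
      by (simp only: \<phi>_frame[of u v] inner_vec_def inner_real_def sum_subtractf)
    also have "\<dots> \<in> \<int>"
    proof (intro Ints_sum Ints_diff)
      fix i
      show "fc u $ i * ec v $ i \<in> \<int>"
        using u v unfolding mem_periods_A by (blast intro: Ints_mult)
      show "(of_int (d i) * ec u $ i) * (fc v $ i / of_int (d i)) \<in> \<int>"
        by (rule Ints_mult) (use u v mem_periods_A in blast)+
    qed
    finally show ?thesis .
  qed
  then show "\<phi> u \<in> periods (dual_torus A)"
    by (simp add: dual_torus_def)
qed

lemma dual_J: "cstruct (dual_torus A) (\<phi> u) = \<phi> (cstruct A u)"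
proof (rule blinfun_eqI)
  fix v
  show "cstruct (dual_torus A) (\<phi> u) v = \<phi> (cstruct A u) v"
    using J_isom[of "cstruct A u" v] by (simp add: cstruct_dual_torus blinfun.minus_left blinfun.minus_right)
qed

text \<open>Identify \<open>V\<close> with its dual by \<open>\<phi>\<close>, so that \<open>V \<times> V\<^sup>*\<close> becomes two copies of \<open>V\<close>. The two copies of the
\<open>e\<close>-half form the Lagrangian identified with the product of the curves, the two copies of
the \<open>f\<close>-half the complementary one, identified with its dual.\<close>

definition \<alpha> :: "(complex ^ 'n) \<times> ((complex ^ 'n) \<Rightarrow>\<^sub>L real) \<Rightarrow> 'v \<times> ('v \<Rightarrow>\<^sub>L real)" where
  "\<alpha> = (\<lambda>(z, w). (ev (yc z) - fv (pc w), \<phi> (ev (sc z) - fv (qc w))))"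

definition \<beta> :: "'v \<times> ('v \<Rightarrow>\<^sub>L real) \<Rightarrow> (complex ^ 'n) \<times> ((complex ^ 'n) \<Rightarrow>\<^sub>L real)" where
  "\<beta> = (\<lambda>(v, \<eta>). (vec_of (ec v) (ec (\<phi>_inv \<eta>)), covec_of (- fc v) (- fc (\<phi>_inv \<eta>))))"

lemma linear_\<alpha>: "linear \<alpha>"
proof (rule linearI)
  fix x y :: "(complex ^ 'n) \<times> ((complex ^ 'n) \<Rightarrow>\<^sub>L real)" and r
  show "\<alpha> (x + y) = \<alpha> x + \<alpha> y"
    by (cases x; cases y) (simp add: \<alpha>_def blinfun.add_right blinfun.diff_right)
  show "\<alpha> (r *\<^sub>R x) = r *\<^sub>R \<alpha> x"
    by (cases x) (simp add: \<alpha>_def blinfun.scaleR_right blinfun.diff_right algebra_simps)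
qed

lemma \<beta>_\<alpha>: "\<beta> (\<alpha> x) = x"
  by (cases x) (simp add: \<alpha>_def \<beta>_def)

lemma \<alpha>_\<beta>: "\<alpha> (\<beta> y) = y"
  by (cases y) (simp add: \<alpha>_def \<beta>_def flip: frame_expand)

lemma \<alpha>_mem_Lambda: "\<alpha> x \<in> Lambda A \<longleftrightarrow> x \<in> Lambda (prod_torus E)"
  by (cases x) (auto simp: \<alpha>_def Lambda_def mem_periods_A mem_periods_dual_A mem_periods_E mem_periods_dual_E)

lemma bij_\<alpha>: "bij_betw \<alpha> (Lambda (prod_torus E)) (Lambda A)"
  by (rule bij_betwI[where g = \<beta>])
    (auto simp: \<beta>_\<alpha> \<alpha>_\<beta> \<alpha>_mem_Lambda simp flip: \<alpha>_mem_Lambda[of "\<beta> _"])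

lemma Q_\<alpha>: "Q_form (\<alpha> x) (\<alpha> y) = Q_form x y"
proof (cases x; cases y)
  fix z w z' w' assume "x = (z, w)" "y = (z', w')"
  then show ?thesis
    using covec_expand[of w z'] covec_expand[of w' z]
    by (simp add: \<alpha>_def \<phi>_frame inner_commute)
qed

lemma I_cscale_\<phi>:
  "I_omega (cscale \<tau> \<phi>) (v, \<phi> u) =
    ((Re \<tau> / Im \<tau>) *\<^sub>R v - (1 / Im \<tau>) *\<^sub>R u,
     \<phi> ((Im \<tau> + (Re \<tau>)\<^sup>2 / Im \<tau>) *\<^sub>R v - (Re \<tau> / Im \<tau>) *\<^sub>R u))"
proof -
  have scale: "\<phi>_inv (c *\<^sub>R \<eta>) = c *\<^sub>R \<phi>_inv \<eta>" for c \<eta>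
    by (rule \<phi>_eqD) (simp add: blinfun.scaleR_right)
  have "inv (blinfun_apply (Im \<tau> *\<^sub>R \<phi>)) = (\<lambda>\<eta>. (1 / Im \<tau>) *\<^sub>R \<phi>_inv \<eta>)"
    by (rule inv_equality) (use Im_nz in \<open>simp_all add: blinfun.scaleR_left blinfun.scaleR_right scale\<close>)
  then show ?thesis
    using Im_nz
    by (simp add: cscale_def blinfun.scaleR_left blinfun.scaleR_right blinfun.add_right blinfun.diff_right
        scale scaleR_add_left power2_eq_square)
qed

lemma \<alpha>_J: "\<alpha> (J_prod_dual (prod_torus E) x) = I_omega (cscale \<tau> \<phi>) (\<alpha> x)"
proof (cases x)
  fix z w assume x: "x = (z, w)"
  show ?thesis
    unfolding x J_prod_dual.simps \<alpha>_def prod.case I_cscale_\<phi> yc_J sc_J pc_dual_J qc_dual_J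
    by (auto simp: algebra_simps)
qed

text \<open>The blocks of \<open>J\<close> in the symplectic frame. Transversality says that \<open>Jef\<close>, the part
from the \<open>f\<close>-half to the \<open>e\<close>-half, is invertible; up to sign it is the upper right block of the
transported complex structure, whose negated inverse is the imaginary part of \<open>\<omega>E\<close>.\<close>

definition Jee :: "real ^ 'n \<Rightarrow> real ^ 'n" where "Jee x = ec (cstruct A (ev x))"
definition Jfe :: "real ^ 'n \<Rightarrow> real ^ 'n" where "Jfe x = fc (cstruct A (ev x))"
definition Jef :: "real ^ 'n \<Rightarrow> real ^ 'n" where "Jef x = ec (cstruct A (fv x))"
definition Jff :: "real ^ 'n \<Rightarrow> real ^ 'n" where "Jff x = fc (cstruct A (fv x))"

lemma linear_blocks: "linear Jee" "linear Jfe" "linear Jef" "linear Jff"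
  by (auto intro!: linearI simp: Jee_def Jfe_def Jef_def Jff_def blinfun.add_right blinfun.scaleR_right)

lemmas blocks_linear [simp] =
  linear_blocks[THEN linear_add] linear_blocks[THEN linear_diff] linear_blocks[THEN linear_neg]
  linear_blocks[THEN linear_scale] linear_blocks[THEN linear_0]

lemma J_ev: "cstruct A (ev x) = ev (Jee x) + fv (Jfe x)"
  and J_fv: "cstruct A (fv x) = ev (Jef x) + fv (Jff x)"
  unfolding Jee_def Jfe_def Jef_def Jff_def by (rule frame_expand)+

lemma blocks_square:
  "Jee (Jef x) + Jef (Jff x) = 0"
  "Jee (Jee x) + Jef (Jfe x) = - x"
proof -
  have "ec (cstruct A (cstruct A (fv x))) = Jee (Jef x) + Jef (Jff x)"
    unfolding J_fv[of x] by (simp add: blinfun.add_right Jee_def Jef_def)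
  then show "Jee (Jef x) + Jef (Jff x) = 0"
    by simp
  have "ec (cstruct A (cstruct A (ev x))) = Jee (Jee x) + Jef (Jfe x)"
    unfolding J_ev[of x] by (simp add: blinfun.add_right Jee_def Jef_def)
  then show "Jee (Jee x) + Jef (Jfe x) = - x"
    by simp
qed

lemma Jef_sym: "Jef x \<bullet> y = x \<bullet> Jef y"
  using J_isom[of "fv x" "cstruct A (fv y)"]
  by (simp add: \<phi>_frame Jef_def[symmetric] Jff_def[symmetric] inner_commute blinfun.minus_right)

lemma Jee_adj: "Jee x \<bullet> y = - (x \<bullet> Jff y)"
  using J_isom[of "ev x" "cstruct A (fv y)"]
  by (simp add: \<phi>_frame Jee_def[symmetric] Jff_def[symmetric] blinfun.minus_right)

lemma Jef_inj: "Jef x = 0 \<Longrightarrow> x = 0"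
proof -
  assume x: "Jef x = 0"
  have F: "fv y \<in> span (range f)" for y
    unfolding fv_def by (intro span_sum span_scale span_base) auto
  have "fv x = 0"
    by (rule transversal) (use F in \<open>simp_all add: J_fv x\<close>)
  then show "x = 0"
    by (metis fc_fv linear_0[OF linear_fc])
qed

definition K :: "real ^ 'n \<Rightarrow> real ^ 'n" where "K = inv Jef"

lemma inj_Jef: "inj Jef"
  using Jef_inj linear_injective_0[OF linear_blocks(3)] by blast

lemma surj_Jef: "surj Jef"
  using linear_injective_imp_surjective[OF linear_blocks(3) inj_Jef] by simp

lemma K_Jef [simp]: "K (Jef x) = x" and Jef_K [simp]: "Jef (K x) = x"
  by (simp_all add: K_def inj_Jef surj_Jef surj_f_inv_f)

lemma linear_K: "linear K"
  by (rule linearI) (metis K_Jef Jef_K blocks_linear)+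

lemmas K_linear [simp] = linear_K[THEN linear_add] linear_K[THEN linear_diff] linear_K[THEN linear_neg]
  linear_K[THEN linear_scale] linear_K[THEN linear_0]

lemma K_sym: "K x \<bullet> y = x \<bullet> K y"
  using Jef_sym[of "K x" "K y"] by simp

lemma Jff_eq: "Jff x = - K (Jee (Jef x))"
proof -
  have "Jef (Jff x) = - Jee (Jef x)"
    using blocks_square(1)[of x] by (simp add: eq_neg_iff_add_eq_0 add.commute)
  then show ?thesis
    by (metis K_Jef linear_neg[OF linear_K])
qed

lemma Jfe_eq: "Jfe x = - K x - K (Jee (Jee x))"
proof -
  have "Jef (Jfe x) = - x - Jee (Jee x)"
    using blocks_square(2)[of x] by (simp add: algebra_simps)
  then have "Jfe x = K (- x - Jee (Jee x))"
    by (metis K_Jef)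
  then show ?thesis
    by simp
qed

lemma KJee_sym: "K (Jee x) \<bullet> y = x \<bullet> K (Jee y)"
proof -
  have "K (Jee x) \<bullet> y = Jee x \<bullet> K y"
    by (rule K_sym)
  also have "\<dots> = - (x \<bullet> Jff (K y))"
    by (rule Jee_adj)
  also have "\<dots> = x \<bullet> K (Jee y)"
    by (simp add: Jff_eq)
  finally show ?thesis .
qed

definition \<omega>E :: "(complex ^ 'n) form \<times> (complex ^ 'n) form" where
  "\<omega>E = (form_of (\<lambda>x. K (Jee x)), form_of K)"

lemma linear_KJee: "linear (\<lambda>x. K (Jee x))"
  by (rule linearI) simp_all

lemma \<omega>E_NS: "\<omega>E \<in> NS_C0 (prod_torus E)"
proof -
  have "x = 0" if "K x = 0" for x
    using that by (metis Jef_K linear_0[OF linear_blocks(3)])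
  then show ?thesis
    unfolding NS_C0_def \<omega>E_def
    using form_of_mem_NS_R[OF linear_KJee KJee_sym] form_of_mem_NS_R[OF linear_K K_sym]
    by (simp add: linear_K nondegenerate_form_of)
qed

lemma inv_form_of_K:
  "inv (blinfun_apply (form_of K)) = (\<lambda>w. vec_of (Jef (pc w)) (Jef (qc w)))"
  by (rule inv_equality) (simp_all add: form_of[OF linear_K])

text \<open>The lower row of the matrix \<open>I_omega\<close> is forced by the upper one because the square is
\<open>-1\<close>; the equations for \<open>Jff\<close> and \<open>Jfe\<close> say the same for \<open>J\<close>.\<close>

lemma I_\<omega>E:
  "I_omega \<omega>E (z, w) =
    (vec_of (Jee (yc z) - Jef (pc w)) (Jee (sc z) - Jef (qc w)),
     covec_of (- (Jfe (yc z) - Jff (pc w))) (- (Jfe (sc z) - Jff (qc w))))"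
  unfolding \<omega>E_def I_omega.simps Let_def inv_form_of_K
  by (auto intro!: coords_eqI covec_eqI simp: form_of[OF linear_K] form_of[OF linear_KJee] Jff_eq Jfe_eq)

lemma \<alpha>_I: "\<alpha> (I_omega \<omega>E x) = J_prod_dual A (\<alpha> x)"
proof (cases x)
  fix z w assume x: "x = (z, w)"
  show ?thesis
    unfolding x I_\<omega>E by (simp add: \<alpha>_def dual_J blinfun.diff_right J_ev J_fv)
      (simp add: algebra_simps blinfun.add_right blinfun.diff_right)
qed

lemma elliptic_curve_E: "elliptic_curve (E i)"
  unfolding E_def by (rule elliptic_curve_curve[OF Im_nz d_nz])

theorem mirror: "mirror_symmetric (prod_torus E, \<omega>E) (A, cscale \<tau> \<phi>)"
proof -
  have "complex_torus (prod_torus E)"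
    using elliptic_curve_E by (intro complex_torus_prod) (simp add: elliptic_curve_def)
  moreover have "cscale \<tau> \<phi> \<in> NS_C0 A"
    using \<phi>_NS nondegenerate_\<phi> Im_nz
    by (auto simp: cscale_def NS_C0_def NS_R_def nondegenerate_def blinfun.scaleR_left intro: span_scale span_base)
  moreover have "\<alpha> \<circ> J_prod_dual (prod_torus E) = I_omega (cscale \<tau> \<phi>) \<circ> \<alpha>"
    and "\<alpha> \<circ> I_omega \<omega>E = J_prod_dual A \<circ> \<alpha>"
    by (simp_all only: fun_eq_iff o_apply \<alpha>_J \<alpha>_I simp_thms)
  ultimately show ?thesis
    using torus \<omega>E_NS linear_\<alpha> bij_\<alpha> Q_\<alpha> unfolding mirror_symmetric.simps weak_pair.simps by blast
qed

end

section \<open>Mirror partners of complex tori with a nondegenerate form\<close>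

lemma hermitian_lattice_periods:
  fixes A :: "'v::euclidean_space ctorus"
  assumes torus: "complex_torus A" and NS: "\<phi> \<in> NS A" and nondeg: "nondegenerate \<phi>"
  shows "hermitian_lattice \<phi> (periods A) (cstruct A)"
proof (rule hermitian_lattice.intro)
  have full: "full_lattice (periods A)"
    using torus by (simp add: complex_torus_def)
  note span = full_lattice_span[OF full]
  show "0 \<in> periods A"
    by (rule full_lattice_zero[OF full])
  show "linear (cstruct A)"
    by (rule bounded_linear.linear[OF blinfun.bounded_linear_right])
  fix x y
  show "x - y \<in> periods A" if "x \<in> periods A" "y \<in> periods A"
    using full that by (rule full_lattice_diff)
  show "\<phi> x y = - \<phi> y x"
    using NS unfolding NS_def by blast
  show "\<phi> x y \<in> \<int>" if "x \<in> periods A" "y \<in> periods A"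
    using NS that unfolding NS_def by blast
  show "\<phi> (cstruct A x) (cstruct A y) = \<phi> x y"
    using NS unfolding NS_def by blast
  show "cstruct A x \<in> span (periods A)"
    by (simp add: span)
  have "(cstruct A o\<^sub>L cstruct A) x = (- id_blinfun) x"
    using torus by (simp add: complex_torus_def)
  then show "cstruct A (cstruct A x) = - x"
    by (simp add: blinfun.minus_left)
  show "x = 0" if "\<And>y. y \<in> periods A \<Longrightarrow> \<phi> x y = 0"
  proof -
    have "\<phi> x y = 0" if "y \<in> span (periods A)" for y
      using that \<open>\<And>y. y \<in> periods A \<Longrightarrow> \<phi> x y = 0\<close>
      by (induction y rule: span_induct_alt) (simp_all add: blinfun.add_right blinfun.scaleR_right)
    then show ?thesis
      using nondeg by (simp add: span nondegenerate_def)
  qed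
qed

theorem proposition9p6p1:
  fixes A :: "'v::euclidean_space ctorus" and \<phi> :: "'v form" and \<tau> :: complex
  assumes "complex_torus A" and "torus_dim A = CARD('n::finite)"
    and "\<phi> \<in> NS A" and "nondegenerate \<phi>"
    and "Im \<tau> \<noteq> 0"
  shows "\<exists>(E :: 'n \<Rightarrow> complex ctorus) \<omega>E.
           (\<forall>i. elliptic_curve (E i)) \<and> (\<forall>i j. isogenous (E i) (E j)) \<and>
           \<omega>E \<in> NS_C0 (prod_torus E) \<and>
           mirror_symmetric (prod_torus E, \<omega>E) (A, cscale \<tau> \<phi>)"
proof -
  obtain n e f d where dim: "dim (periods A) = 2 * n" and d: "\<forall>i<n. 0 < (d i :: int)"
    and rel: "\<forall>i<n. \<forall>j<n. \<phi> (e i) (e j) = 0 \<and> \<phi> (f i) (f j) = 0 \<and>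
      \<phi> (e i) (f j) = (if i = j then of_int (d i) else 0)"
    and per: "periods A = {\<Sum>i<n. of_int (k i) *\<^sub>R e i + of_int (l i) *\<^sub>R f i | k l. True}"
    and trans: "\<forall>w \<in> span (f ` {..<n}). cstruct A w \<in> span (f ` {..<n}) \<longrightarrow> w = 0"
    using ex_symplectic_basis_transversal[OF hermitian_lattice_periods[OF assms(1,3,4)]] by blast
  have "dim (UNIV :: 'v set) = 2 * n"
    using dim assms(1) by (metis complex_torus_def full_lattice_span dim_span)
  then have n: "CARD('n) = n"
    using assms(2) by (simp add: torus_dim_def)
  obtain h :: "'n \<Rightarrow> nat" where h: "bij_betw h UNIV {..<n}"
    using ex_bij_betw_finite_nat[of "UNIV :: 'n set"] by (auto simp: n atLeast0LessThan)
  have h_less: "h i < n" for i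
    using h by (auto simp: bij_betw_def)
  have h_eq: "h i = h j \<longleftrightarrow> i = j" for i j
    using h by (auto simp: bij_betw_def inj_on_def)
  have range_f: "range (f \<circ> h) = f ` {..<n}"
    using bij_betw_imp_surj_on[OF h] by (metis image_comp)
  have reindex: "(\<Sum>i<n. g i) = (\<Sum>i\<in>UNIV. g (h i))" for g :: "nat \<Rightarrow> 'v"
    by (rule sum.reindex_bij_betw[OF h, symmetric])
  have periods: "periods A =
      {\<Sum>i\<in>UNIV. of_int (k i) *\<^sub>R (e \<circ> h) i + of_int (l i) *\<^sub>R (f \<circ> h) i | k l. True}" (is "_ = ?R")
  proof (intro equalityI subsetI)
    fix v assume "v \<in> periods A"
    then obtain k l where "v = (\<Sum>i<n. of_int (k i) *\<^sub>R e i + of_int (l i) *\<^sub>R f i)"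
      unfolding per by blast
    then have "v = (\<Sum>i\<in>UNIV. of_int ((k \<circ> h) i) *\<^sub>R (e \<circ> h) i + of_int ((l \<circ> h) i) *\<^sub>R (f \<circ> h) i)"
      by (simp add: reindex)
    then show "v \<in> ?R"
      by blast
  next
    fix v assume "v \<in> ?R"
    then obtain k l where
      v: "v = (\<Sum>i\<in>UNIV. of_int (k i) *\<^sub>R (e \<circ> h) i + of_int (l i) *\<^sub>R (f \<circ> h) i)"
      by blast
    have "inv h (h i) = i" for i
      using h_eq by (simp add: inj_def)
    then have "v = (\<Sum>i<n. of_int ((k \<circ> inv h) i) *\<^sub>R e i + of_int ((l \<circ> inv h) i) *\<^sub>R f i)"
      by (simp add: reindex v)
    then show "v \<in> periods A"
      unfolding per by blast
  qed
  interpret transversal_lagrangian_splitting \<tau> "d \<circ> h" A \<phi> "e \<circ> h" "f \<circ> h"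
  proof unfold_locales
    show "w = 0" if "w \<in> span (range (f \<circ> h))" "cstruct A w \<in> span (range (f \<circ> h))" for w
      using trans that unfolding range_f by blast
  qed (use assms d rel h_less in \<open>simp_all add: h_eq periods\<close>)
  show ?thesis
    using elliptic_curve_E \<omega>E_NS mirror isogenous_curve d_pos
    by (intro exI[of _ E] exI[of _ \<omega>E]) (simp add: E_def)
qed

end
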